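(* Let $k\ge4$ be even, and let $r\ge2$, $N\ge1$ be integers. Suppose there exists an $r$-coloring of $\mathbb{Z}/N\mathbb{Z}$ with no symmetrically colored $k$-AP. Then for every $\epsilon>0$ there is a constant $C$ (depending on $k,r,N,\epsilon$) such that for all $0<\alpha<1$, \[\widetilde\rho_k(\alpha)\le C\alpha^{k-1+(\log_rN)/(k-1)-\epsilon}.\]
   Context: In $\mathbb{Z}/N\mathbb{Z}$, for even $k$, a $k$-AP $n,n+d,\dots,n+(k-1)d$ with $d\ne0$ is symmetrically colored if $n+(i-1)d$ and $n+(k-i)d$ have the same color for each $i=1,\dots,k/2$. $\mathbb{T}=\mathbb{R}/\mathbb{Z}$. $F\colon\mathbb{T}^2\to[0,1]$ has constant first marginal $\alpha$ if $\int_\mathbb{T}F(x,y)\,dy=\alpha$ for a.e. $x$. $\widetilde\Lambda_k(F)=\mathbb{E}_{(x,y)\in V}\prod_{i=1}^kF(x_i,y_i)$ (Haar measure on $V$), where $V\subset\mathbb{T}^{2k}$ consists of $(x_1,\dots,x_k,y_1,\dots,y_k)$ with $x_2-x_1=\cdots=x_k-x_{k-1}$ and $\sum_{i=1}^k(-1)^i\binom{k-1}{i-1}y_i=0$. $\widetilde\rho_k(\alpha)$ is the infimum of $\widetilde\Lambda_k(F)$ over Riemann integrable $F\colon\mathbb{T}^2\to[0,1]$ with constant first marginal $\alpha$. *)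

theory Defs
  imports "HOL-Probability.Probability"
begin

section \<open>The circle group\<close>

quotient_type circle = real / "\<lambda>x y :: real. x - y \<in> \<int>"
proof (rule equivpI)
  show "reflp (\<lambda>x y :: real. x - y \<in> \<int>)"
    by (simp add: reflp_def)
  show "symp (\<lambda>x y :: real. x - y \<in> \<int>)"
    unfolding symp_def by (metis Ints_minus minus_diff_eq)
  show "transp (\<lambda>x y :: real. x - y \<in> \<int>)"
    unfolding transp_def by (metis Ints_add diff_add_cancel add_diff_eq)
qed

lift_definition circle_of :: "real \<Rightarrow> circle" is "\<lambda>x. x" .

instantiation circle :: ab_group_add
begin

lift_definition zero_circle :: circle is "0 :: real" .

lift_definition plus_circle :: "circle \<Rightarrow> circle \<Rightarrow> circle" is "(+) :: real \<Rightarrow> real \<Rightarrow> real"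
  by (metis Ints_add add_diff_add)

lift_definition minus_circle :: "circle \<Rightarrow> circle \<Rightarrow> circle" is "(-) :: real \<Rightarrow> real \<Rightarrow> real"
proof -
  fix a b c d :: real
  assume "a - b \<in> \<int>" "c - d \<in> \<int>"
  then have "(a - b) - (c - d) \<in> \<int>"
    by (rule Ints_diff)
  then show "(a - c) - (b - d) \<in> \<int>"
    by (simp add: algebra_simps)
qed

lift_definition uminus_circle :: "circle \<Rightarrow> circle" is "uminus :: real \<Rightarrow> real"
  by (metis Ints_minus minus_diff_minus)

instance
  by standard (transfer; simp)+

end

lift_definition int_scale :: "int \<Rightarrow> circle \<Rightarrow> circle" is "\<lambda>n x :: real. of_int n * x"
  by (metis Ints_mult Ints_of_int right_diff_distrib)

text \<open>The quotient topology.\<close>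

instantiation circle :: topological_space
begin

definition open_circle :: "circle set \<Rightarrow> bool" where
  "open_circle U \<longleftrightarrow> open (circle_of -` U)"

instance
proof
  show "open (UNIV :: circle set)"
    by (simp add: open_circle_def)
  show "open (S \<inter> T)" if "open S" "open T" for S T :: "circle set"
    using that by (simp add: open_circle_def vimage_Int open_Int)
  show "open (\<Union>K)" if "\<forall>S\<in>K. open S" for K :: "circle set set"
    using that by (auto simp: open_circle_def vimage_Union intro!: open_UN)
qed

end

definition circle_measure :: "circle measure" where
  "circle_measure = distr (restrict_space lborel {0..<1}) borel circle_of"

section \<open>Riemann integrability\<close>

text \<open>
  In contrast to the gauge in \<^const>\<open>has_integral\<close>, the radius \<open>\<delta>\<close> below is a constant,
  so that this is the Riemann and not the Henstock--Kurzweil integral.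
\<close>

definition riemann_integrable_cbox ::
    "('a::euclidean_space \<Rightarrow> real) \<Rightarrow> 'a \<Rightarrow> 'a \<Rightarrow> bool" where
  "riemann_integrable_cbox f a b \<longleftrightarrow>
     (\<exists>I. \<forall>e>0. \<exists>\<delta>>0. \<forall>p.
        p tagged_division_of cbox a b \<and> (\<lambda>x. ball x \<delta>) fine p \<longrightarrow>
        \<bar>(\<Sum>(x, K)\<in>p. measure lborel K * f x) - I\<bar> < e)"

definition riemann_integrable_torus :: "(circle \<times> circle \<Rightarrow> real) \<Rightarrow> bool" where
  "riemann_integrable_torus F \<longleftrightarrow>
     riemann_integrable_cbox (\<lambda>(s, t). F (circle_of s, circle_of t)) (0 :: real \<times> real) (1, 1)"

definition constant_first_marginal :: "(circle \<times> circle \<Rightarrow> real) \<Rightarrow> real \<Rightarrow> bool" where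
  "constant_first_marginal F \<alpha> \<longleftrightarrow>
     (AE x in circle_measure. has_bochner_integral (completion circle_measure) (\<lambda>y. F (x, y)) \<alpha>)"

section \<open>The group V and its Haar measure\<close>

text \<open>
  A point of \<open>T\<close> to the power \<open>2k\<close> is a pair of functions that are \<^const>\<open>undefined\<close>
  outside \<open>{1..k}\<close>.
\<close>

type_synonym config = "(nat \<Rightarrow> circle) \<times> (nat \<Rightarrow> circle)"

definition V :: "nat \<Rightarrow> config set" where
  "V k = {(x, y). x \<in> extensional {1..k} \<and> y \<in> extensional {1..k} \<and>
     (\<exists>d. \<forall>i\<in>{1..<k}. x (i + 1) - x i = d) \<and>
     (\<Sum>i=1..k. int_scale ((-1) ^ i * int ((k - 1) choose (i - 1))) (y i)) = 0}"

definition translate :: "nat \<Rightarrow> config \<Rightarrow> config \<Rightarrow> config" where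
  "translate k v w =
     (\<lambda>i\<in>{1..k}. fst v i + fst w i, \<lambda>i\<in>{1..k}. snd v i + snd w i)"

text \<open>
  Since the circle is second countable, the product sigma-algebra below is the Borel
  sigma-algebra, so \<open>V_haar k\<close> is the normalised Haar measure of the compact group \<open>V k\<close>.
\<close>

definition V_haar :: "nat \<Rightarrow> config measure" where
  "V_haar k = (THE \<mu>.
     sets \<mu> = sets (restrict_space
       ((\<Pi>\<^sub>M i\<in>{1..k}. (borel :: circle measure)) \<Otimes>\<^sub>M (\<Pi>\<^sub>M i\<in>{1..k}. (borel :: circle measure))) (V k)) \<and>
     prob_space \<mu> \<and>
     (\<forall>v\<in>V k. distr \<mu> \<mu> (translate k v) = \<mu>))"

section \<open>The extremal quantity\<close>

text \<open>
  The completion matters: a Riemann integrable function need not be Borel measurable, and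
  the Bochner integral of a non-measurable function is 0 by convention.
\<close>

definition Lambda_tilde :: "nat \<Rightarrow> (circle \<times> circle \<Rightarrow> real) \<Rightarrow> real" where
  "Lambda_tilde k F = (\<integral>(x, y). (\<Prod>i=1..k. F (x i, y i)) \<partial>completion (V_haar k))"

definition rho_tilde :: "nat \<Rightarrow> real \<Rightarrow> real" where
  "rho_tilde k \<alpha> =
     (INF F\<in>{F. range F \<subseteq> {0..1} \<and> riemann_integrable_torus F \<and> constant_first_marginal F \<alpha>}.
        Lambda_tilde k F)"

section \<open>Symmetrically colored progressions\<close>

text \<open>Elements of \<open>Z/NZ\<close> are represented by their residues in \<open>{..<N}\<close>.\<close>

definition symmetrically_colored :: "nat \<Rightarrow> nat \<Rightarrow> (nat \<Rightarrow> nat) \<Rightarrow> nat \<Rightarrow> nat \<Rightarrow> bool" where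
  "symmetrically_colored N k c n d \<longleftrightarrow>
     (\<forall>i\<in>{1..k div 2}. c ((n + (i - 1) * d) mod N) = c ((n + (k - i) * d) mod N))"

end

theory Submission imports Defs begin

text \<open>
  Let \<open>a\<^sub>i\<close> be the coefficients of the linear equation defining \<open>V\<close>; for even \<open>k\<close> they satisfy
  \<open>a\<^sub>i = - a\<^bsub>k+1-i\<^esub>\<close> and have no other coincidences of absolute values.  Color the circle by the
  base-\<open>B\<close> digits of \<open>x\<close>, where \<open>B = N\<^sup>s\<close>: record the given coloring of each of the first \<open>m\<close> digits,
  the leading part of every fractional part (to control carries), and, as in Behrend's
  construction, the sum of the squares of the digits.  Unless \<open>q d\<close> is within \<open>B\<^sup>-\<^sup>m\<close> of \<open>0\<close> for some
  \<open>0 < q < k\<close>, no three terms of a progression with difference \<open>d\<close> share a color, so if all color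
  classes had zero total coefficient, they would be the mirror pairs, and some digit would give a
  symmetrically colored progression modulo \<open>B\<close>.

  Hence with \<open>R\<close> colors one can greedily choose integers \<open>p\<^sub>c\<close> of size \<open>O(R\<^sup>k\<^sup>-\<^sup>1)\<close> such that the linear
  form does not vanish at the points attached to the terms of such a progression.  Let \<open>F\<close> be the
  indicator of the \<open>y\<close> in an interval of length \<open>\<alpha>\<close> starting at the rescaled point of the color of
  \<open>x\<close>.  Then only the exceptional \<open>d\<close>, of measure \<open>O(B\<^sup>-\<^sup>m)\<close>, contribute, each of them at most
  \<open>\<alpha>\<^sup>k\<^sup>-\<^sup>1\<close>.  The leading parts and the sum of squares cost only a factor \<open>k\<^sup>m\<^sup>+\<^sup>1 (m B\<^sup>2 + 1)\<close> in \<open>R\<close>, which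
  is absorbed by \<open>\<epsilon>\<close> once \<open>s\<close> is large.
\<close>

section \<open>The circle\<close>

text \<open>The representative in [0, 1). It turns the group operations into real arithmetic
  followed by \<open>circle_of\<close>, which is how their measurability is obtained.\<close>

lift_definition crep :: "circle \<Rightarrow> real" is frac
proof -
  fix x y :: real assume "x - y \<in> \<int>"
  then obtain n where "x = y + of_int n" by (metis Ints_cases add.commute diff_add_cancel)
  then show "frac x = frac y" by (simp add: frac_def)
qed

lemma crep_circle_of [simp]: "crep (circle_of x) = frac x"
  by transfer simp

lemma circle_of_eq_iff: "circle_of x = circle_of y \<longleftrightarrow> x - y \<in> \<int>"
  by transfer simp

lemma circle_of_crep [simp]: "circle_of (crep z) = z"
  by transfer (simp add: frac_def)

lemma crep_nonneg [simp]: "0 \<le> crep z" and crep_less_1 [simp]: "crep z < 1"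
  by (transfer, simp add: frac_lt_1)+

lemma circle_of_add: "circle_of (x + y) = circle_of x + circle_of y"
  and circle_of_0: "circle_of 0 = 0"
  and circle_of_int_scale: "circle_of (of_int n * x) = int_scale n (circle_of x)"
  by (transfer, simp)+

lemma circle_of_sum: "circle_of (\<Sum>i\<in>I. f i) = (\<Sum>i\<in>I. circle_of (f i))"
  by (induction I rule: infinite_finite_induct) (simp_all add: circle_of_0 circle_of_add)

lemma circle_of_eq_0_iff: "circle_of x = 0 \<longleftrightarrow> x \<in> \<int>"
  using circle_of_eq_iff[of x 0] by (simp add: circle_of_0)

lemma plus_conv_crep: "z + w = circle_of (crep z + crep w)"
  by (simp add: circle_of_add)

lemma int_scale_conv_crep: "int_scale n z = circle_of (of_int n * crep z)"
  by (simp add: circle_of_int_scale)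

lemma int_scale_add: "int_scale n (z + w) = int_scale n z + int_scale n w"
  by transfer (simp add: algebra_simps)

lemma int_scale_add_left: "int_scale (m + n) z = int_scale m z + int_scale n z"
  by transfer (simp add: algebra_simps)

lemma int_scale_0 [simp]: "int_scale 0 z = 0" and int_scale_1 [simp]: "int_scale 1 z = z"
  by (transfer, simp)+

lemma int_scale_uminus_1 [simp]: "int_scale (- 1) z = - z"
  by transfer simp

section \<open>Borel structure of the circle\<close>

lemma continuous_circle_of: "continuous_on UNIV circle_of"
  unfolding continuous_on_open_vimage[OF open_UNIV] by (auto simp: open_circle_def)

lemma measurable_circle_of [measurable]: "circle_of \<in> borel_measurable borel"
  using continuous_circle_of by (rule borel_measurable_continuous_onI)

text \<open>The preimage under \<open>circle_of\<close> is a union of open intervals, one per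
  integer. The point 0 is left out because \<open>crep\<close> jumps there.\<close>

lemma open_crep_between: "open {z. 0 < crep z \<and> crep z < a}"
proof -
  have "circle_of -` {z. 0 < crep z \<and> crep z < a} = (\<Union>n::int. {of_int n<..<of_int n + min a 1})"
  proof (intro equalityI subsetI)
    fix x assume "x \<in> circle_of -` {z. 0 < crep z \<and> crep z < a}"
    then have "0 < frac x" "frac x < a" by auto
    then have "x \<in> {of_int \<lfloor>x\<rfloor><..<of_int \<lfloor>x\<rfloor> + min a 1}"
      using frac_lt_1[of x] by (auto simp: frac_def)
    then show "x \<in> (\<Union>n::int. {of_int n<..<of_int n + min a 1})" by blast
  next
    fix x assume "x \<in> (\<Union>n::int. {of_int n<..<of_int n + min a 1})"
    then obtain n :: int where n: "of_int n < x" "x < of_int n + min a 1" by auto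
    then have "\<lfloor>x\<rfloor> = n" by (intro floor_unique) auto
    with n show "x \<in> circle_of -` {z. 0 < crep z \<and> crep z < a}" by (auto simp: frac_def)
  qed
  then show ?thesis unfolding open_circle_def by (auto intro!: open_UN)
qed

lemma closed_singleton_0_circle: "closed {0 :: circle}"
proof -
  have "circle_of -` (- {0}) = - \<int>" by (auto simp: circle_of_eq_0_iff)
  then show ?thesis unfolding closed_def open_circle_def
    by (simp add: closed_Ints open_Compl)
qed

lemma measurable_crep [measurable]: "crep \<in> borel_measurable borel"
proof (subst borel_measurable_iff_less, intro allI)
  fix a :: real
  \<comment> \<open>A sublevel set need not be open, but for positive a it is the open set above
    together with the closed point 0.\<close>
  have "{z. crep z < a} = (if a \<le> 0 then {} else insert 0 {z. 0 < crep z \<and> crep z < a})"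
  proof (cases "a \<le> 0")
    case True then have "\<not> crep z < a" for z using crep_nonneg[of z] by linarith
    then show ?thesis using True by auto
  next
    case False
    have "crep z = 0 \<longleftrightarrow> z = 0" for z
    proof
      assume "crep z = 0" then have "circle_of (crep z) = circle_of 0" by simp
      then show "z = 0" by (simp only: circle_of_crep circle_of_0)
    next
      assume "z = 0" then show "crep z = 0" using crep_circle_of[of 0] by (simp add: circle_of_0)
    qed
    moreover have "crep z < a \<longleftrightarrow> crep z = 0 \<or> 0 < crep z \<and> crep z < a" for z
      using False crep_nonneg[of z] by linarith
    ultimately show ?thesis using False by (simp add: set_eq_iff)
  qed
  also have "\<dots> \<in> sets borel"
    using borel_open[OF open_crep_between[of a]] borel_closed[OF closed_singleton_0_circle]
      sets.insert_in_sets[of 0 borel "{z. 0 < crep z \<and> crep z < a}"] by simp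
  finally show "{w \<in> space borel. crep w < a} \<in> sets borel" by simp
qed

lemma measurable_circle_plus [measurable]:
  assumes "f \<in> M \<rightarrow>\<^sub>M (borel :: circle measure)" "g \<in> M \<rightarrow>\<^sub>M borel"
  shows "(\<lambda>x. f x + g x) \<in> M \<rightarrow>\<^sub>M borel"
  unfolding plus_conv_crep using assms by measurable

lemma measurable_int_scale [measurable]:
  assumes "f \<in> M \<rightarrow>\<^sub>M borel"
  shows "(\<lambda>x. int_scale n (f x)) \<in> M \<rightarrow>\<^sub>M borel"
  unfolding int_scale_conv_crep using assms by measurable

lemma measurable_circle_sum [measurable]:
  assumes "\<And>i. i \<in> I \<Longrightarrow> f i \<in> M \<rightarrow>\<^sub>M (borel :: circle measure)"
  shows "(\<lambda>x. \<Sum>i\<in>I. f i x) \<in> M \<rightarrow>\<^sub>M borel"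
  using assms by (induction I rule: infinite_finite_induct) auto

section \<open>Translation invariance of the measure on the circle\<close>

lemma sets_circle_measure [simp, measurable_cong]: "sets circle_measure = sets borel"
  and space_circle_measure [simp]: "space circle_measure = UNIV"
  by (simp_all add: circle_measure_def)

lemma emeasure_circle_measure:
  assumes "A \<in> sets borel"
  shows "emeasure circle_measure A = emeasure lborel ({0..<1} \<inter> circle_of -` A)"
proof -
  have m: "circle_of \<in> restrict_space lborel {0..<1} \<rightarrow>\<^sub>M borel"
    by (rule measurable_restrict_space1) simp
  show ?thesis unfolding circle_measure_def
    by (subst emeasure_distr[OF m assms], subst emeasure_restrict_space)
      (auto simp: space_restrict_space Int_commute intro!: arg_cong[where f = "emeasure lborel"])
qed

interpretation circle_prob: prob_space circle_measure
  by standard (simp add: emeasure_circle_measure)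

lemma circle_vimage_add_of_int: "circle_of (x + of_int n) = circle_of x"
  by (simp add: circle_of_eq_iff)

text \<open>Shifting the left-hand set by c puts it into [c, 1 + c). Cutting there at 1 and moving
  the right piece back by 1, under which \<open>circle_of\<close> does not change, reassembles [0,
  1).\<close>

lemma lborel_circle_shift:
  assumes A: "A \<in> sets borel" and c: "0 \<le> c" "c < 1"
  shows "emeasure lborel ({0..<1} \<inter> (\<lambda>t. circle_of (c + t)) -` A) =
    emeasure lborel ({0..<1} \<inter> circle_of -` A)"
proof -
  let ?S = "circle_of -` A"
  have S[measurable]: "?S \<in> sets borel" using A measurable_sets[OF measurable_circle_of A] by simp
  have shift: "emeasure lborel ((\<lambda>t. b + t) -` X) = emeasure lborel X" if "X \<in> sets borel" for b :: real and X
    using that by (subst (2) lborel_distr_plus[of b, symmetric], subst emeasure_distr) auto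
  have "{0..<1} \<inter> (\<lambda>t. circle_of (c + t)) -` A = (\<lambda>t. c + t) -` ({c..<1+c} \<inter> ?S)" by auto
  then have "emeasure lborel ({0..<1} \<inter> (\<lambda>t. circle_of (c + t)) -` A) = emeasure lborel ({c..<1+c} \<inter> ?S)"
    by (simp only:) (rule shift, simp)
  also have "{c..<1+c} \<inter> ?S = ({c..<1} \<inter> ?S) \<union> ({1..<1+c} \<inter> ?S)" using c by auto
  also have "emeasure lborel \<dots> = emeasure lborel ({c..<1} \<inter> ?S) + emeasure lborel ({1..<1+c} \<inter> ?S)"
    by (rule plus_emeasure[symmetric]) auto
  also have "emeasure lborel ({1..<1+c} \<inter> ?S) = emeasure lborel ((\<lambda>t. 1 + t) -` ({1..<1+c} \<inter> ?S))"
    by (rule shift[symmetric]) simp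
  also have "(\<lambda>t. 1 + t) -` ({1..<1+c} \<inter> ?S) = {0..<c} \<inter> ?S"
    using circle_vimage_add_of_int[of _ 1] by (auto simp: add.commute)
  also have "emeasure lborel ({c..<1} \<inter> ?S) + emeasure lborel ({0..<c} \<inter> ?S) = emeasure lborel (({c..<1} \<inter> ?S) \<union> ({0..<c} \<inter> ?S))"
    by (rule plus_emeasure) auto
  also have "({c..<1} \<inter> ?S) \<union> ({0..<c} \<inter> ?S) = {0..<1} \<inter> ?S" using c by auto
  finally show ?thesis .
qed

lemma circle_measure_translate: "distr circle_measure circle_measure ((+) z) = circle_measure"
proof (rule measure_eqI)
  fix A assume "A \<in> sets (distr circle_measure circle_measure ((+) z))"
  then have A: "A \<in> sets borel" by simp
  have m: "(+) z \<in> circle_measure \<rightarrow>\<^sub>M circle_measure" by measurable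
  have m2: "(+) z -` A \<in> sets borel" using measurable_sets[OF m, of A] A by simp
  have "emeasure (distr circle_measure circle_measure ((+) z)) A = emeasure circle_measure ((+) z -` A)"
    using A by (simp add: emeasure_distr[OF m])
  also have "\<dots> = emeasure lborel ({0..<1} \<inter> (\<lambda>t. circle_of (crep z + t)) -` A)"
    by (subst emeasure_circle_measure[OF m2]) (simp add: circle_of_add vimage_def)
  also have "\<dots> = emeasure circle_measure A"
    using A by (simp add: lborel_circle_shift emeasure_circle_measure)
  finally show "emeasure (distr circle_measure circle_measure ((+) z)) A = emeasure circle_measure A" .
qed simp

section \<open>Haar measure on V\<close>

text \<open>Up to a common sign, the coefficients of the finite difference of order k - 1.\<close>

definition vcoeff :: "nat \<Rightarrow> nat \<Rightarrow> int" where
  "vcoeff k i = (-1) ^ i * int ((k - 1) choose (i - 1))"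

definition V_sigma :: "nat \<Rightarrow> config measure" where
  "V_sigma k = restrict_space
       ((\<Pi>\<^sub>M i\<in>{1..k}. (borel :: circle measure)) \<Otimes>\<^sub>M (\<Pi>\<^sub>M i\<in>{1..k}. (borel :: circle measure))) (V k)"

lemma V_iff: "v \<in> V k \<longleftrightarrow> fst v \<in> extensional {1..k} \<and> snd v \<in> extensional {1..k} \<and>
     (\<exists>d. \<forall>i\<in>{1..<k}. fst v (i + 1) - fst v i = d) \<and>
     (\<Sum>i=1..k. int_scale (vcoeff k i) (snd v i)) = 0"
  by (auto simp: V_def vcoeff_def split: prod.splits)

lemma space_V_sigma: "space (V_sigma k) = V k"
  by (auto simp: V_sigma_def space_restrict_space space_pair_measure space_PiM V_def PiE_def)

lemma translate_in_V:
  assumes "v \<in> V k" "w \<in> V k" shows "translate k v w \<in> V k"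
proof -
  obtain d where d: "\<forall>i\<in>{1..<k}. fst v (i + 1) - fst v i = d" using assms(1) by (auto simp: V_iff)
  obtain e where e: "\<forall>i\<in>{1..<k}. fst w (i + 1) - fst w i = e" using assms(2) by (auto simp: V_iff)
  have "fst (translate k v w) (i + 1) - fst (translate k v w) i = d + e" if "i \<in> {1..<k}" for i
  proof -
    have "fst (translate k v w) (i + 1) - fst (translate k v w) i
        = (fst v (i + 1) - fst v i) + (fst w (i + 1) - fst w i)"
      using that by (simp add: translate_def)
    then show ?thesis using d e that by simp
  qed
  moreover have "(\<Sum>i=1..k. int_scale (vcoeff k i) (snd (translate k v w) i)) =
     (\<Sum>i=1..k. int_scale (vcoeff k i) (snd v i)) + (\<Sum>i=1..k. int_scale (vcoeff k i) (snd w i))"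
    by (simp add: translate_def int_scale_add sum.distrib)
  then have "(\<Sum>i=1..k. int_scale (vcoeff k i) (snd (translate k v w) i)) = 0"
    using assms by (simp add: V_iff)
  ultimately show ?thesis unfolding V_iff by (auto simp: translate_def)
qed

lemma translate_commute: "translate k v w = translate k w v"
  by (simp add: translate_def add.commute)

text \<open>Measurability jointly in both arguments is what Fubini requires in the uniqueness proof
  for invariant measures.\<close>

lemma measurable_translate:
  "(\<lambda>(v, w). translate k v w) \<in> V_sigma k \<Otimes>\<^sub>M V_sigma k \<rightarrow>\<^sub>M V_sigma k"
  unfolding V_sigma_def[of k] measurable_restrict_space2_iff
proof (fold V_sigma_def, intro conjI)
  let ?S = "(\<Pi>\<^sub>M i\<in>{1..k}. (borel :: circle measure)) \<Otimes>\<^sub>M (\<Pi>\<^sub>M i\<in>{1..k}. (borel :: circle measure))"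
  show "(\<lambda>(v, w). translate k v w) \<in> space (V_sigma k \<Otimes>\<^sub>M V_sigma k) \<rightarrow> V k"
    by (auto simp: space_pair_measure space_V_sigma translate_in_V)
  have id: "(\<lambda>v. v) \<in> V_sigma k \<rightarrow>\<^sub>M ?S"
    unfolding V_sigma_def by (rule measurable_restrict_space1) simp
  have [measurable]: "(\<lambda>p. fst p) \<in> V_sigma k \<Otimes>\<^sub>M V_sigma k \<rightarrow>\<^sub>M ?S" "(\<lambda>p. snd p) \<in> V_sigma k \<Otimes>\<^sub>M V_sigma k \<rightarrow>\<^sub>M ?S"
    by (rule measurable_compose[OF measurable_fst id], rule measurable_compose[OF measurable_snd id])
  show "(\<lambda>(v, w). translate k v w) \<in> V_sigma k \<Otimes>\<^sub>M V_sigma k \<rightarrow>\<^sub>M ?S"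
    unfolding translate_def case_prod_beta' by measurable
qed

lemma measurable_translate1:
  assumes "v \<in> V k" shows "translate k v \<in> V_sigma k \<rightarrow>\<^sub>M V_sigma k"
proof -
  have "Pair v \<in> V_sigma k \<rightarrow>\<^sub>M V_sigma k \<Otimes>\<^sub>M V_sigma k"
    using assms by (intro measurable_Pair1') (simp add: space_V_sigma)
  from measurable_compose[OF this measurable_translate] show ?thesis by simp
qed

text \<open>Fubini on the product of two invariant measures shows that they agree.\<close>

lemma invariant_measure_unique:
  assumes \<mu>: "sets \<mu> = sets (V_sigma k)" "prob_space \<mu>" "\<And>v. v \<in> V k \<Longrightarrow> distr \<mu> \<mu> (translate k v) = \<mu>"
    and \<nu>: "sets \<nu> = sets (V_sigma k)" "prob_space \<nu>" "\<And>v. v \<in> V k \<Longrightarrow> distr \<nu> \<nu> (translate k v) = \<nu>"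
  shows "\<mu> = \<nu>"
proof (rule measure_eqI)
  show "sets \<mu> = sets \<nu>" using \<mu>(1) \<nu>(1) by simp
  fix A assume "A \<in> sets \<mu>"
  then have A: "A \<in> sets (V_sigma k)" using \<mu>(1) by simp
  interpret \<mu>: prob_space \<mu> by fact
  interpret \<nu>: prob_space \<nu> by fact
  interpret pair_sigma_finite \<mu> \<nu> ..
  have sp: "space \<mu> = V k" "space \<nu> = V k"
    using sets_eq_imp_space_eq[OF \<mu>(1)] sets_eq_imp_space_eq[OF \<nu>(1)] by (simp_all add: space_V_sigma)
  have T: "(\<lambda>(v, w). translate k v w) \<in> \<mu> \<Otimes>\<^sub>M \<nu> \<rightarrow>\<^sub>M V_sigma k"
    using measurable_translate measurable_cong_sets[OF sets_pair_measure_cong[OF \<mu>(1) \<nu>(1)] refl] by blast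
  have inv: "(\<integral>\<^sup>+ w. indicator A (translate k v w) \<partial>M) = emeasure M A"
    if "v \<in> V k" "sets M = sets (V_sigma k)" "distr M M (translate k v) = M" for M v
  proof -
    have m: "translate k v \<in> M \<rightarrow>\<^sub>M M" using measurable_translate1[OF that(1)] measurable_cong_sets[OF that(2) that(2)] by blast
    have "emeasure M A = (\<integral>\<^sup>+ w. indicator A w \<partial>distr M M (translate k v))"
      using A that by simp
    also have "\<dots> = (\<integral>\<^sup>+ w. indicator A (translate k v w) \<partial>M)"
      using A that(2) by (intro nn_integral_distr[OF m]) simp
    finally show ?thesis by simp
  qed
  have meas: "(\<lambda>(v, w). indicator A (translate k v w) :: ennreal) \<in> borel_measurable (\<mu> \<Otimes>\<^sub>M \<nu>)"
    using measurable_compose[OF T borel_measurable_indicator[OF A]] by (simp add: case_prod_beta')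
  \<comment> \<open>For fixed v, invariance of \<nu> makes the inner integral the mass of A. After
    the exchange of integrals, commutativity of \<open>translate\<close> lets \<mu> play the same
    part.\<close>
  have "emeasure \<nu> A = (\<integral>\<^sup>+ v. \<integral>\<^sup>+ w. indicator A (translate k v w) \<partial>\<nu> \<partial>\<mu>)"
    using \<nu> by (subst nn_integral_cong[of \<mu> _ "\<lambda>_. emeasure \<nu> A"]) (auto simp: sp inv \<mu>.emeasure_space_1[unfolded sp])
  also have "\<dots> = (\<integral>\<^sup>+ w. \<integral>\<^sup>+ v. indicator A (translate k v w) \<partial>\<mu> \<partial>\<nu>)"
    using Fubini[OF meas] by simp
  also have "\<dots> = emeasure \<mu> A"
    using \<mu> by (subst nn_integral_cong[of \<nu> _ "\<lambda>_. emeasure \<mu> A"])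
      (auto simp: sp inv translate_commute[of k _ w for w] \<nu>.emeasure_space_1[unfolded sp])
  finally show "emeasure \<mu> A = emeasure \<nu> A" by simp
qed

text \<open>The free parameters of a point of \<open>V k\<close>, drawn independently: first term
  and common difference of the progression, and the coordinates y_2, ..., y_k.\<close>

definition V_param_measure :: "nat \<Rightarrow> ((circle \<times> circle) \<times> (nat \<Rightarrow> circle)) measure" where
  "V_param_measure k =
     (circle_measure \<Otimes>\<^sub>M circle_measure) \<Otimes>\<^sub>M (\<Pi>\<^sub>M i\<in>{2..k}. circle_measure)"

text \<open>As \<^term>\<open>vcoeff k 1 = -1\<close>, the linear equation can be solved for \<open>y\<^sub>1\<close>.\<close>

definition V_param :: "nat \<Rightarrow> (circle \<times> circle) \<times> (nat \<Rightarrow> circle) \<Rightarrow> config" where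
  "V_param k = (\<lambda>((x, d), y).
     (\<lambda>i\<in>{1..k}. x + int_scale (int i - 1) d,
      \<lambda>i\<in>{1..k}. if i = 1 then \<Sum>j=2..k. int_scale (vcoeff k j) (y j) else y i))"

lemma sum_atLeastAtMost_1: "1 \<le> k \<Longrightarrow> (\<Sum>i=1..k::nat. f i) = f 1 + (\<Sum>i=2..k. f i)"
  by (simp add: sum.atLeast_Suc_atMost numeral_2_eq_2)

lemma vcoeff_1 [simp]: "vcoeff k 1 = -1" "vcoeff k (Suc 0) = -1"
  by (simp_all add: vcoeff_def)

lemma V_param_in_V:
  assumes "k \<ge> 1" shows "V_param k p \<in> V k"
proof -
  obtain x d y where p: "p = ((x, d), y)" by (metis surj_pair)
  have "fst (V_param k p) (i + 1) - fst (V_param k p) i = d" if "i \<in> {1..<k}" for i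
    using int_scale_add_left[of "int i - 1" 1 d] that by (simp add: p V_param_def)
  moreover have "(\<Sum>i=1..k. int_scale (vcoeff k i) (snd (V_param k p) i)) = 0"
    using assms by (subst sum_atLeastAtMost_1) (auto simp: p V_param_def)
  ultimately show ?thesis unfolding V_iff by (auto simp: V_param_def p)
qed

text \<open>Surjectivity allows every translation of \<open>V k\<close> to be lifted to the
  parameters. The terms of the progression are recovered by induction from the first one, and y_1
  from the linear equation.\<close>

lemma V_param_surj:
  assumes "k \<ge> 1" "v \<in> V k" shows "\<exists>p. v = V_param k p"
proof -
  obtain d where d: "\<forall>i\<in>{1..<k}. fst v (i + 1) - fst v i = d" using assms(2) by (auto simp: V_iff)
  have x: "fst v (Suc i) = fst v 1 + int_scale (int i) d" if "i < k" for i
    using that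
  proof (induction i)
    case (Suc i)
    then have "fst v (Suc (Suc i)) = fst v (Suc i) + d" using d by (force simp: algebra_simps)
    then show ?case using Suc int_scale_add_left[of "int i" 1 d] by (simp add: algebra_simps)
  qed simp
  have "(\<Sum>i=1..k. int_scale (vcoeff k i) (snd v i)) = 0" using assms(2) by (simp add: V_iff)
  then have "- snd v 1 + (\<Sum>j=2..k. int_scale (vcoeff k j) (snd v j)) = 0"
    using sum_atLeastAtMost_1[OF assms(1), of "\<lambda>i. int_scale (vcoeff k i) (snd v i)"]
    by simp
  then have y: "snd v 1 = (\<Sum>j=2..k. int_scale (vcoeff k j) (snd v j))"
    by (simp add: neg_eq_iff_add_eq_0[symmetric])
  have "v = V_param k ((fst v 1, d), snd v)"
  proof (rule prod_eqI)
    show "fst v = fst (V_param k ((fst v 1, d), snd v))"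
    proof
      fix i
      show "fst v i = fst (V_param k ((fst v 1, d), snd v)) i"
        using x[of "i - 1"] assms(2)
        by (cases "i \<in> {1..k}") (auto simp: V_param_def V_iff extensional_def of_nat_diff)
    qed
    show "snd v = snd (V_param k ((fst v 1, d), snd v))"
      using y assms(2) by (auto simp: V_param_def V_iff extensional_def fun_eq_iff)
  qed
  then show ?thesis by blast
qed

lemma measurable_V_param: 
  assumes "k \<ge> 1" shows "V_param k \<in> V_param_measure k \<rightarrow>\<^sub>M V_sigma k"
  unfolding V_sigma_def
proof (rule measurable_restrict_space2)
  show "V_param k \<in> space (V_param_measure k) \<rightarrow> V k" using V_param_in_V[OF assms] by auto
  show "V_param k \<in> V_param_measure k \<rightarrow>\<^sub>M (\<Pi>\<^sub>M i\<in>{1..k}. borel) \<Otimes>\<^sub>M (\<Pi>\<^sub>M i\<in>{1..k}. borel)"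
    unfolding V_param_def V_param_measure_def case_prod_beta'
  proof (intro measurable_Pair measurable_restrict)
    fix i assume "i \<in> {1..k}"
    then show "(\<lambda>x. if i = 1 then \<Sum>j = 2..k. int_scale (vcoeff k j) (snd x j) else snd x i)
         \<in> (circle_measure \<Otimes>\<^sub>M circle_measure) \<Otimes>\<^sub>M Pi\<^sub>M {2..k} (\<lambda>i. circle_measure) \<rightarrow>\<^sub>M borel"
      by (cases "i = 1") auto
  qed measurable
qed

text \<open>\<open>V_param\<close> is a homomorphism, so translations of the parameters become
  translations of \<open>V k\<close>.\<close>

lemma translate_V_param:
  "translate k (V_param k ((x, d), y)) (V_param k ((x', d'), y')) =
     V_param k ((x + x', d + d'), \<lambda>i\<in>{2..k}. y i + y' i)"
  by (auto simp: translate_def V_param_def fun_eq_iff int_scale_add algebra_simps sum.distrib intro!: sum.cong)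

lemma circle_pair_translate:
  "distr (circle_measure \<Otimes>\<^sub>M circle_measure) (circle_measure \<Otimes>\<^sub>M circle_measure) (\<lambda>(x, d). (x' + x, d' + d))
     = circle_measure \<Otimes>\<^sub>M circle_measure"
  by (subst pair_measure_distr[symmetric])
    (auto simp: circle_measure_translate circle_prob.sigma_finite_measure_axioms)

text \<open>The product measure is determined by its values on boxes, and the preimage of a box
  under a translation is a box whose sides have the same measures.\<close>

lemma circle_PiM_translate:
  fixes I :: "nat set" assumes "finite I"
  shows "distr (\<Pi>\<^sub>M i\<in>I. circle_measure) (\<Pi>\<^sub>M i\<in>I. circle_measure) (\<lambda>y. \<lambda>i\<in>I. y' i + y i)
     = (\<Pi>\<^sub>M i\<in>I. circle_measure)"
proof -
  interpret product_prob_space "\<lambda>_ :: nat. circle_measure" by standard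
  have m: "(\<lambda>y. \<lambda>i\<in>I. y' i + y i) \<in> (\<Pi>\<^sub>M i\<in>I. circle_measure) \<rightarrow>\<^sub>M (\<Pi>\<^sub>M i\<in>I. circle_measure)"
    by measurable
  show ?thesis
  proof (rule PiM_eqI[OF assms])
    fix A :: "nat \<Rightarrow> circle set" assume A: "\<And>i. i \<in> I \<Longrightarrow> A i \<in> sets circle_measure"
    have tr: "(+) (y' i) -` A i \<in> sets circle_measure \<and> emeasure circle_measure ((+) (y' i) -` A i) = emeasure circle_measure (A i)" if "i \<in> I" for i
    proof -
      have m: "(+) (y' i) \<in> circle_measure \<rightarrow>\<^sub>M circle_measure" by measurable
      have "emeasure (distr circle_measure circle_measure ((+) (y' i))) (A i) = emeasure circle_measure ((+) (y' i) -` A i)"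
        using emeasure_distr[OF m A[OF that]] by simp
      then show ?thesis using measurable_sets[OF m A[OF that]] by (simp add: circle_measure_translate)
    qed
    have "emeasure (distr (\<Pi>\<^sub>M i\<in>I. circle_measure) (\<Pi>\<^sub>M i\<in>I. circle_measure) (\<lambda>y. \<lambda>i\<in>I. y' i + y i)) (Pi\<^sub>E I A)
      = emeasure (\<Pi>\<^sub>M i\<in>I. circle_measure) (\<Pi>\<^sub>E i\<in>I. (+) (y' i) -` A i)"
      using A assms by (subst emeasure_distr[OF m])
        (auto simp: sets_PiM_I_finite space_PiM PiE_iff extensional_def intro!: arg_cong[where f = "emeasure _"])
    also have "\<dots> = (\<Prod>i\<in>I. emeasure circle_measure (A i))"
      using tr assms by (subst emeasure_PiM) auto
    finally show "emeasure (distr (\<Pi>\<^sub>M i\<in>I. circle_measure) (\<Pi>\<^sub>M i\<in>I. circle_measure) (\<lambda>y. \<lambda>i\<in>I. y' i + y i)) (Pi\<^sub>E I A)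
      = (\<Prod>i\<in>I. emeasure circle_measure (A i))" .
  qed simp
qed

lemma prob_space_circle_PiM: "prob_space (\<Pi>\<^sub>M i\<in>I. circle_measure)"
  by (intro prob_space_PiM) (rule circle_prob.prob_space_axioms)

lemma prob_space_circle_pair: "prob_space (circle_measure \<Otimes>\<^sub>M circle_measure)"
  by (intro prob_space_pair circle_prob.prob_space_axioms)

lemma prob_space_V_param_measure: "prob_space (V_param_measure k)"
  unfolding V_param_measure_def
  by (intro prob_space_pair prob_space_circle_pair prob_space_circle_PiM)

lemma V_param_measure_translate:
  "distr (V_param_measure k) (V_param_measure k) (\<lambda>((x, d), y). ((x' + x, d' + d), \<lambda>i\<in>{2..k}. y' i + y i))
     = V_param_measure k"
proof -
  interpret P: prob_space "\<Pi>\<^sub>M i\<in>{2..k}. circle_measure" by (rule prob_space_circle_PiM)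
  have m1: "(\<lambda>(x, d). (x' + x, d' + d)) \<in> (circle_measure \<Otimes>\<^sub>M circle_measure) \<rightarrow>\<^sub>M (circle_measure \<Otimes>\<^sub>M circle_measure)"
    by measurable
  have m2: "(\<lambda>y. \<lambda>i\<in>{2..k}. y' i + y i) \<in> (\<Pi>\<^sub>M i\<in>{2..k}. circle_measure) \<rightarrow>\<^sub>M (\<Pi>\<^sub>M i\<in>{2..k}. circle_measure)"
    by measurable
  have "sigma_finite_measure (distr (\<Pi>\<^sub>M i\<in>{2..k}. circle_measure) (\<Pi>\<^sub>M i\<in>{2..k}. circle_measure) (\<lambda>y. \<lambda>i\<in>{2..k}. y' i + y i))"
    using P.sigma_finite_measure_axioms by (simp add: circle_PiM_translate)
  from pair_measure_distr[OF m1 m2 this] show ?thesis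
    by (simp add: circle_pair_translate[unfolded case_prod_beta'] circle_PiM_translate V_param_measure_def case_prod_beta')
qed

text \<open>The image of an invariant measure under a surjective homomorphism is invariant. Together
  with uniqueness, this makes the description by \<open>THE\<close> in \<open>V_haar\<close> denote
  this image.\<close>

lemma V_haar_eq:
  assumes "k \<ge> 1"
  shows "V_haar k = distr (V_param_measure k) (V_sigma k) (V_param k)"
  unfolding V_haar_def V_sigma_def[symmetric]
proof (rule the_equality)
  let ?\<mu> = "distr (V_param_measure k) (V_sigma k) (V_param k)"
  note m = measurable_V_param[OF assms]
  have inv: "distr ?\<mu> ?\<mu> (translate k v) = ?\<mu>" if v: "v \<in> V k" for v
  proof -
    obtain x' d' y' where p: "v = V_param k ((x', d'), y')" using V_param_surj[OF assms v] by auto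
    let ?T = "\<lambda>((x, d), y). ((x' + x, d' + d), \<lambda>i\<in>{2..k}. y' i + y i)"
    have mT: "?T \<in> V_param_measure k \<rightarrow>\<^sub>M V_param_measure k"
      unfolding V_param_measure_def case_prod_beta' by measurable
    have "distr ?\<mu> ?\<mu> (translate k v) = distr ?\<mu> (V_sigma k) (translate k v)"
      by (rule distr_cong) auto
    also have "\<dots> = distr (V_param_measure k) (V_sigma k) (translate k v \<circ> V_param k)"
      by (rule distr_distr[OF measurable_translate1[OF v] m])
    also have "translate k v \<circ> V_param k = V_param k \<circ> ?T"
      by (auto simp: fun_eq_iff p translate_V_param)
    also have "distr (V_param_measure k) (V_sigma k) (V_param k \<circ> ?T) = distr (distr (V_param_measure k) (V_param_measure k) ?T) (V_sigma k) (V_param k)"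
      by (rule distr_distr[OF m mT, symmetric])
    also have "\<dots> = ?\<mu>" by (simp add: V_param_measure_translate)
    finally show ?thesis .
  qed
  have pr: "prob_space ?\<mu>" by (rule prob_space.prob_space_distr[OF prob_space_V_param_measure m])
  show "sets ?\<mu> = sets (V_sigma k) \<and> prob_space ?\<mu> \<and> (\<forall>v\<in>V k. distr ?\<mu> ?\<mu> (translate k v) = ?\<mu>)"
    using inv pr by simp
  fix \<nu> assume "sets \<nu> = sets (V_sigma k) \<and> prob_space \<nu> \<and> (\<forall>v\<in>V k. distr \<nu> \<nu> (translate k v) = \<nu>)"
  then show "\<nu> = ?\<mu>"
    using inv pr by (intro invariant_measure_unique[of \<nu> k ?\<mu>]) simp_all
qed

section \<open>Strips over step functions\<close>

text \<open>By \<open>step\<close>, points of the square with different values have the second one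
  near one of finitely many vertical or horizontal lines. So in a partition finer than \<delta> each
  summand errs by at most the integral of \<open>H\<close>, the sum of the indicators of strips of
  half-width \<delta> around the lines, and the total error is at most 2 \<delta> n.\<close>

lemma riemann_integrable_step:
  fixes f :: "real \<times> real \<Rightarrow> real"
  assumes AB: "finite A" "finite B"
    and f: "f \<in> borel_measurable borel" "\<And>z. \<bar>f z\<bar> \<le> 1" "\<And>z w. \<bar>f z - f w\<bar> \<le> 1"
    and step: "\<And>s t s' t'. {s, t, s', t'} \<subseteq> {0..1} \<Longrightarrow> f (s, t) \<noteq> f (s', t') \<Longrightarrow>
      (\<exists>a\<in>A. \<bar>s' - a\<bar> \<le> \<bar>s - s'\<bar>) \<or> (\<exists>b\<in>B. \<bar>t' - b\<bar> \<le> \<bar>t - t'\<bar>)"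
  shows "riemann_integrable_cbox f 0 (1, 1)"
  unfolding riemann_integrable_cbox_def
proof (rule exI[of _ "integral (cbox 0 (1, 1)) f"], intro allI impI)
  fix e :: real assume e: "e > 0"
  define n where "n = real (card A + card B)"
  \<comment> \<open>Any \<delta> with 2 \<delta> n < e would do; the summand 1 covers n = 0.\<close>
  define \<delta> where "\<delta> = e / (2 * n + 1)"
  have n: "n \<ge> 0" by (simp add: n_def)
  have \<delta>: "\<delta> > 0" "2 * \<delta> * n < e" using e n by (auto simp: \<delta>_def field_simps intro: add_nonneg_pos)
  \<comment> \<open>The strips may leave the unit square, so each has area exactly 2
    \<delta>.\<close>
  define SA where "SA a = cbox (a - \<delta>, 0) (a + \<delta>, 1 :: real)" for a
  define SB where "SB b = cbox (0 :: real, b - \<delta>) (1, b + \<delta>)" for b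
  define H where "H z = (\<Sum>a\<in>A. indicator (SA a) z) + (\<Sum>b\<in>B. indicator (SB b) z :: real)" for z
  have int_ind: "((\<lambda>z. indicator (cbox u v) z :: real) has_integral measure lborel (cbox u v)) UNIV" for u v :: "real \<times> real"
  proof -
    have "((\<lambda>z. 1 :: real) has_integral measure lborel (cbox u v)) (cbox u v)"
      using emeasure_lborel_cbox_finite[of u v] by (intro has_integral_measure_lborel) (simp_all add: less_top)
    then have "((\<lambda>z. if z \<in> cbox u v then 1 else 0 :: real) has_integral measure lborel (cbox u v)) UNIV"
      by (simp only: has_integral_restrict_UNIV)
    then show ?thesis by (simp only: indicator_def of_bool_def)
  qed
  have HI: "(H has_integral (\<Sum>a\<in>A. measure lborel (SA a)) + (\<Sum>b\<in>B. measure lborel (SB b))) UNIV"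
    unfolding H_def SA_def SB_def using AB by (intro has_integral_add has_integral_sum int_ind)
  have "measure lborel (SA a) = 2 * \<delta>" "measure lborel (SB a) = 2 * \<delta>" for a
    unfolding SA_def SB_def content_Pair using \<delta> by auto
  then have HI': "(H has_integral 2 * \<delta> * n) UNIV" using HI by (simp add: n_def algebra_simps)
  have H_cbox: "H integrable_on cbox u v" for u v
    using HI' by (meson integrable_on_subcbox has_integral_integrable subset_UNIV)
  have H_nonneg: "H z \<ge> 0" for z by (auto simp: H_def intro!: add_nonneg_nonneg sum_nonneg)
  have f_cbox: "f integrable_on cbox u v" for u v
  proof -
    have "integrable lborel (\<lambda>x. indicator (cbox u v) x *\<^sub>R f x)"
      using f emeasure_lborel_cbox_finite[of u v]
      by (intro integrableI_bounded_set[where A = "cbox u v" and B = 1]) (auto simp: indicator_def less_top)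
    then show ?thesis using set_borel_integral_eq_integral(1)[of "cbox u v" f] by (simp add: set_integrable_def)
  qed
  show "\<exists>\<delta>>0. \<forall>p. p tagged_division_of cbox 0 (1, 1) \<and> (\<lambda>x. ball x \<delta>) fine p \<longrightarrow>
     \<bar>(\<Sum>(x, K)\<in>p. measure lborel K * f x) - integral (cbox 0 (1, 1)) f\<bar> < e"
  proof (intro exI[of _ \<delta>] conjI allI impI \<delta>)
    fix p assume "p tagged_division_of cbox 0 (1 :: real, 1 :: real) \<and> (\<lambda>x. ball x \<delta>) fine p"
    then have p: "p tagged_division_of cbox 0 (1, 1)" and fine: "(\<lambda>x. ball x \<delta>) fine p" by auto
    have "finite p" using p by (rule tagged_division_of_finite)
    have local: "\<bar>measure lborel K * f x - integral K f\<bar> \<le> integral K H" if xK: "(x, K) \<in> p" for x K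
    proof -
      obtain u v where K: "K = cbox u v" using tagged_division_ofD(4)[OF p xK] by blast
      have sub: "K \<subseteq> cbox 0 (1, 1)" "x \<in> K" "K \<subseteq> ball x \<delta>"
        using tagged_division_ofD(2,3)[OF p xK] fine xK by (auto simp: fine_def)
      have "measure lborel K * f x - integral K f = integral K (\<lambda>z. f x - f z)"
        unfolding K using f_cbox[of u v] by (subst integral_diff) auto
      moreover have "norm (integral K (\<lambda>z. f x - f z)) \<le> integral K H"
      proof (rule integral_norm_bound_integral)
        show "(\<lambda>z. f x - f z) integrable_on K" unfolding K using f_cbox by (intro integrable_diff) auto
        show "H integrable_on K" unfolding K by (rule H_cbox)
        fix z assume z: "z \<in> K"
        show "norm (f x - f z) \<le> H z"
        proof (cases "f x = f z")
          case False
          obtain s t s' t' where st: "x = (s, t)" "z = (s', t')" by fastforce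
          have in01: "(s, t) \<in> cbox 0 (1, 1)" "(s', t') \<in> cbox 0 (1, 1)" using sub z st by auto
          have "dist x z < \<delta>" using z sub by auto
          then have d: "\<bar>s - s'\<bar> < \<delta>" "\<bar>t - t'\<bar> < \<delta>"
            using dist_fst_le[of x z] dist_snd_le[of x z] by (auto simp: st dist_real_def)
          have "{s, t, s', t'} \<subseteq> {0..1}" using in01 by (auto simp: cbox_Pair_eq zero_prod_def)
          from step[OF this] False st consider a where "a \<in> A" "\<bar>s' - a\<bar> \<le> \<bar>s - s'\<bar>" | b where "b \<in> B" "\<bar>t' - b\<bar> \<le> \<bar>t - t'\<bar>" by auto
          then have "1 \<le> H z"
          proof cases
            case 1
            then have "z \<in> SA a" using d in01 unfolding SA_def st by (auto simp: cbox_Pair_eq zero_prod_def)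
            then have "1 \<le> (\<Sum>a\<in>A. indicator (SA a) z :: real)"
              using member_le_sum[of a A "\<lambda>a. indicator (SA a) z :: real"] 1 AB by simp
            then show ?thesis by (auto simp: H_def intro!: add_increasing2 sum_nonneg)
          next
            case 2
            then have "z \<in> SB b" using d in01 unfolding SB_def st by (auto simp: cbox_Pair_eq zero_prod_def)
            then have "1 \<le> (\<Sum>b\<in>B. indicator (SB b) z :: real)"
              using member_le_sum[of b B "\<lambda>b. indicator (SB b) z :: real"] 2 AB by simp
            then show ?thesis by (auto simp: H_def intro!: add_increasing sum_nonneg)
          qed
          then show ?thesis using f(3)[of x z] by simp
        qed (use H_nonneg in simp)
      qed
      ultimately show ?thesis by simp
    qed
    have "(\<Sum>(x, K)\<in>p. measure lborel K * f x) - integral (cbox 0 (1, 1)) f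
       = (\<Sum>(x, K)\<in>p. measure lborel K * f x - integral K f)"
      by (subst integral_combine_tagged_division_topdown[OF f_cbox p])
        (simp add: sum_subtractf[symmetric] case_prod_beta')
    also have "\<bar>\<dots>\<bar> \<le> (\<Sum>(x, K)\<in>p. integral K H)"
      using local by (intro order_trans[OF sum_abs] sum_mono) auto
    also have "\<dots> = integral (cbox 0 (1, 1)) H"
      by (rule integral_combine_tagged_division_topdown[OF H_cbox p, symmetric])
    also have "\<dots> \<le> integral UNIV H"
      using HI' H_nonneg by (intro integral_subset_le H_cbox) auto
    also have "\<dots> = 2 * \<delta> * n" using HI' by (rule integral_unique)
    also have "\<dots> < e" by (rule \<delta>)
    finally show "\<bar>(\<Sum>(x, K)\<in>p. measure lborel K * f x) - integral (cbox 0 (1, 1)) f\<bar> < e" .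
  qed
qed

text \<open>Representatives in [0, 1) are compared, so an interval that passes 1 would be cut off
  and not wrap around. This is why \<open>g s + \<alpha> \<le> 1\<close> is assumed where the
  marginal is computed.\<close>

definition strip :: "(real \<Rightarrow> real) \<Rightarrow> real \<Rightarrow> circle \<times> circle \<Rightarrow> real" where
  "strip g \<alpha> = (\<lambda>(x, y). if g (crep x) \<le> crep y \<and> crep y < g (crep x) + \<alpha> then 1 else 0)"

lemma strip_measurable:
  assumes [measurable]: "g \<in> borel_measurable borel"
  shows "strip g \<alpha> \<in> borel_measurable (borel \<Otimes>\<^sub>M borel)"
  unfolding strip_def case_prod_beta' by measurable

lemma strip_riemann_integrable:
  assumes g: "g \<in> borel_measurable borel" "finite (range g)" and A: "finite A"
    and step: "\<And>s s'. s \<in> {0..<1} \<Longrightarrow> s' \<in> {0..<1} \<Longrightarrow> g s \<noteq> g s' \<Longrightarrow> \<exists>a\<in>A. \<bar>s' - a\<bar> \<le> \<bar>s - s'\<bar>"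
  shows "riemann_integrable_torus (strip g \<alpha>)"
  unfolding riemann_integrable_torus_def
proof (rule riemann_integrable_step)
  let ?f = "\<lambda>(s, t). strip g \<alpha> (circle_of s, circle_of t)"
  \<comment> \<open>The jumps in the second coordinate are at the ends of the intervals. The value 1
    is added on both axes since \<open>circle_of\<close> sends 1 to the same point as 0.\<close>
  let ?B = "insert 1 (range g \<union> (\<lambda>x. x + \<alpha>) ` range g)"
  show "finite (insert 1 A)" "finite ?B" using A g(2) by auto
  have "(\<lambda>z. (circle_of (fst z), circle_of (snd z))) \<in> borel \<Otimes>\<^sub>M borel \<rightarrow>\<^sub>M borel \<Otimes>\<^sub>M borel" by measurable
  from measurable_compose[OF this strip_measurable[OF g(1)]]
  show "?f \<in> borel_measurable borel" by (simp add: borel_prod case_prod_beta')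
  show "\<bar>?f z\<bar> \<le> 1" "\<bar>?f z - ?f w\<bar> \<le> 1" for z w by (auto simp: strip_def case_prod_beta')
  fix s t s' t' :: real
  assume in01: "{s, t, s', t'} \<subseteq> {0..1}" and ne: "?f (s, t) \<noteq> ?f (s', t')"
  show "(\<exists>a\<in>insert 1 A. \<bar>s' - a\<bar> \<le> \<bar>s - s'\<bar>) \<or> (\<exists>b\<in>?B. \<bar>t' - b\<bar> \<le> \<bar>t - t'\<bar>)"
  proof (cases "s = 1 \<or> s' = 1 \<or> t = 1 \<or> t' = 1")
    case True
    then show ?thesis by (auto simp: abs_minus_commute)
  next
    case False
    then have fr: "frac s = s" "frac s' = s'" "frac t = t" "frac t' = t'" "s \<in> {0..<1}" "s' \<in> {0..<1}"
      using in01 by (auto simp: frac_eq)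
    show ?thesis
    proof (cases "g s = g s'")
      case True
      then have "(g s \<le> t \<and> t < g s + \<alpha>) \<noteq> (g s \<le> t' \<and> t' < g s + \<alpha>)"
        using ne by (auto simp: strip_def fr split: if_splits)
      then have "\<bar>t' - g s\<bar> \<le> \<bar>t - t'\<bar> \<or> \<bar>t' - (g s + \<alpha>)\<bar> \<le> \<bar>t - t'\<bar>" by linarith
      then show ?thesis by auto
    next
      case False
      then show ?thesis using step fr by blast
    qed
  qed
qed

lemma emeasure_circle_interval:
  assumes "0 \<le> a" "a + \<alpha> \<le> 1" "0 \<le> \<alpha>"
  shows "emeasure circle_measure {y. a \<le> crep y \<and> crep y < a + \<alpha>} = ennreal \<alpha>"
proof -
  have "{y. a \<le> crep y \<and> crep y < a + \<alpha>} \<in> sets borel" by measurable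
  then have "emeasure circle_measure {y. a \<le> crep y \<and> crep y < a + \<alpha>}
    = emeasure lborel ({0..<1} \<inter> circle_of -` {y. a \<le> crep y \<and> crep y < a + \<alpha>})"
    by (rule emeasure_circle_measure)
  also have "{0..<1} \<inter> circle_of -` {y. a \<le> crep y \<and> crep y < a + \<alpha>} = {a..<a + \<alpha>}"
    using assms by (auto simp: frac_eq)
  finally show ?thesis using assms by simp
qed

lemma strip_constant_first_marginal:
  assumes "\<And>s. 0 \<le> g s" "\<And>s. g s + \<alpha> \<le> 1" "0 \<le> \<alpha>"
  shows "constant_first_marginal (strip g \<alpha>) \<alpha>"
  unfolding constant_first_marginal_def
proof (rule AE_I2)
  fix x
  let ?S = "{y. g (crep x) \<le> crep y \<and> crep y < g (crep x) + \<alpha>}"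
  have S: "?S \<in> sets circle_measure" by measurable
  have eq: "emeasure (completion circle_measure) ?S = ennreal \<alpha>"
    using emeasure_circle_interval[OF assms] S by simp
  have "has_bochner_integral (completion circle_measure) (indicator ?S) (measure (completion circle_measure) ?S)"
    using S eq by (intro has_bochner_integral_real_indicator) (auto intro: sets_completionI_sets)
  moreover have "measure (completion circle_measure) ?S = \<alpha>" using eq assms(3) by (simp add: measure_def)
  moreover have "(\<lambda>y. strip g \<alpha> (x, y)) = indicator ?S" by (auto simp: strip_def indicator_def fun_eq_iff)
  ultimately show "has_bochner_integral (completion circle_measure) (\<lambda>y. strip g \<alpha> (x, y)) \<alpha>" by simp
qed

section \<open>Upper bounds through strips\<close>

lemma Lambda_tilde_nonneg: "range F \<subseteq> {0..1} \<Longrightarrow> 0 \<le> Lambda_tilde k F"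
  unfolding Lambda_tilde_def by (intro integral_nonneg_AE AE_I2) (force intro!: prod_nonneg)

lemma rho_tilde_le:
  assumes "range F \<subseteq> {0..1}" "riemann_integrable_torus F" "constant_first_marginal F \<alpha>"
  shows "rho_tilde k \<alpha> \<le> Lambda_tilde k F"
  unfolding rho_tilde_def
  by (rule cINF_lower) (use assms in \<open>auto intro!: bdd_belowI2[where m = 0] Lambda_tilde_nonneg\<close>)

text \<open>By \<open>none\<close>, the product can be nonzero only for differences in
  \<open>E\<close>. For each of these, y_2, ..., y_k are independent and each must lie in an
  interval of length \<alpha>.\<close>

lemma Lambda_tilde_strip_le:
  assumes k: "k \<ge> 1" and g: "g \<in> borel_measurable borel" "\<And>s. 0 \<le> g s" "\<And>s. g s + \<alpha> \<le> 1" "0 \<le> \<alpha>"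
    and E: "E \<in> sets borel"
    and none: "\<And>x d y. d \<notin> E \<Longrightarrow> (\<Sum>i=1..k. int_scale (vcoeff k i) (y i)) = 0 \<Longrightarrow>
       (\<And>i. i \<in> {1..k} \<Longrightarrow> strip g \<alpha> (x + int_scale (int i - 1) d, y i) = 1) \<Longrightarrow> False"
  shows "Lambda_tilde k (strip g \<alpha>) \<le> \<alpha> ^ (k - 1) * measure circle_measure E"
proof -
  let ?F = "strip g \<alpha>"
  let ?P = "V_param_measure k"
  interpret P: prob_space ?P by (rule prob_space_V_param_measure)
  interpret Y: product_prob_space "\<lambda>_ :: nat. circle_measure" by standard
  interpret Y': prob_space "\<Pi>\<^sub>M i\<in>{2..k}. circle_measure" by (rule prob_space_circle_PiM)
  interpret X: prob_space "circle_measure \<Otimes>\<^sub>M circle_measure" by (rule prob_space_circle_pair)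
  note [measurable] = strip_measurable[OF g(1)] E
  note m = measurable_V_param[OF k]
  define \<Phi> where "\<Phi> v = (\<Prod>i=1..k. ?F (fst v i, snd v i))" for v :: config
  have \<Phi>: "\<Phi> \<in> borel_measurable (V_sigma k)"
    unfolding V_sigma_def \<Phi>_def by (rule measurable_restrict_space1) measurable
  have F01: "0 \<le> ?F z" "?F z \<le> 1" "?F z = 0 \<or> ?F z = 1" for z by (auto simp: strip_def case_prod_beta')
  \<comment> \<open>The index 1 is omitted because y_1 is a function of the other parameters; what
    remains is, for fixed x and d, a box in y_2, ..., y_k.\<close>
  define Q where "Q = {p \<in> space ?P. snd (fst p) \<in> E \<and>
    (\<forall>i\<in>{2..k}. ?F (fst (fst p) + int_scale (int i - 1) (snd (fst p)), snd p i) = 1)}"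
  have Q: "Q \<in> sets ?P"
    unfolding Q_def V_param_measure_def by measurable
  have "Lambda_tilde k ?F = (\<integral>v. \<Phi> v \<partial>completion (V_haar k))"
    by (simp add: Lambda_tilde_def \<Phi>_def case_prod_beta')
  also have "\<dots> = (\<integral>v. \<Phi> v \<partial>V_haar k)" using \<Phi> by (intro integral_completion) (simp add: V_haar_eq[OF k])
  also have "\<dots> = (\<integral>p. \<Phi> (V_param k p) \<partial>?P)" unfolding V_haar_eq[OF k] by (rule integral_distr[OF m \<Phi>])
  also have "\<dots> \<le> (\<integral>p. indicator Q p \<partial>?P)"
  proof (rule integral_mono)
    show "integrable ?P (\<lambda>p. \<Phi> (V_param k p))"
    proof (rule P.integrable_const_bound[where B = 1])
      show "(\<lambda>p. \<Phi> (V_param k p)) \<in> borel_measurable ?P" by (rule measurable_compose[OF m \<Phi>])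
      have "0 \<le> \<Phi> v \<and> \<Phi> v \<le> 1" for v unfolding \<Phi>_def using F01 by (intro conjI prod_nonneg prod_le_1) auto
      then show "AE p in ?P. norm (\<Phi> (V_param k p)) \<le> 1" by (intro AE_I2) (simp add: abs_le_iff)
    qed
    show "integrable ?P (indicator Q :: _ \<Rightarrow> real)" using Q by (simp add: integrable_real_indicator P.emeasure_eq_measure)
    fix p assume p: "p \<in> space ?P"
    show "\<Phi> (V_param k p) \<le> indicator Q p"
    proof (cases "\<Phi> (V_param k p) = 0")
      case False
      then have one: "?F (fst (V_param k p) i, snd (V_param k p) i) = 1" if "i \<in> {1..k}" for i
        using that F01(3)[of "(fst (V_param k p) i, snd (V_param k p) i)"] unfolding \<Phi>_def
        by (auto simp: prod_zero_iff)
      obtain x d y where xdy: "p = ((x, d), y)" by (metis surj_pair)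
      have "(\<Sum>i=1..k. int_scale (vcoeff k i) (snd (V_param k p) i)) = 0"
        using V_param_in_V[OF k, of p] by (simp add: V_iff)
      then have "d \<in> E" using none[of d "snd (V_param k p)" x] one by (auto simp: V_param_def xdy)
      moreover have "?F (x + int_scale (int i - 1) d, y i) = 1" if "i \<in> {2..k}" for i
        using one[of i] that by (simp add: V_param_def xdy)
      ultimately have "p \<in> Q" using p by (simp add: Q_def xdy)
      moreover have "\<Phi> (V_param k p) \<le> 1" unfolding \<Phi>_def using F01 by (intro prod_le_1) auto
      ultimately show ?thesis by simp
    qed simp
  qed
  also have "\<dots> = measure ?P Q" using Q by simp
  also have "\<dots> = \<alpha> ^ (k - 1) * measure circle_measure E"
  proof -
    have "emeasure ?P Q = (\<integral>\<^sup>+ xd. emeasure (\<Pi>\<^sub>M i\<in>{2..k}. circle_measure) (Pair xd -` Q) \<partial>(circle_measure \<Otimes>\<^sub>M circle_measure))"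
      using Q unfolding V_param_measure_def by (rule Y'.emeasure_pair_measure_alt)
    also have "\<dots> = (\<integral>\<^sup>+ xd. ennreal (\<alpha> ^ (k - 1)) * indicator (UNIV \<times> E) xd \<partial>(circle_measure \<Otimes>\<^sub>M circle_measure))"
    proof (rule nn_integral_cong)
      fix xd :: "circle \<times> circle"
      obtain x d where xd: "xd = (x, d)" by fastforce
      let ?a = "\<lambda>i. g (crep (x + int_scale (int i - 1) d))"
      let ?S = "\<lambda>i. {y. ?a i \<le> crep y \<and> crep y < ?a i + \<alpha>}"
      show "emeasure (\<Pi>\<^sub>M i\<in>{2..k}. circle_measure) (Pair xd -` Q) = ennreal (\<alpha> ^ (k - 1)) * indicator (UNIV \<times> E) xd"
      proof (cases "d \<in> E")
        case True
        have "Pair xd -` Q = (\<Pi>\<^sub>E i\<in>{2..k}. ?S i)"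
          using True by (auto simp: Q_def xd V_param_measure_def space_pair_measure space_PiM PiE_iff strip_def extensional_def split: if_splits)
        also have "emeasure (\<Pi>\<^sub>M i\<in>{2..k}. circle_measure) \<dots> = (\<Prod>i\<in>{2..k}. emeasure circle_measure (?S i))"
          by (rule Y.emeasure_PiM) auto
        also have "\<dots> = (\<Prod>i\<in>{2..k}. ennreal \<alpha>)"
          using g by (intro prod.cong emeasure_circle_interval) auto
        also have "\<dots> = ennreal (\<alpha> ^ (k - 1))" using g(4) k by (simp add: ennreal_power)
        finally show ?thesis using True by (simp add: xd)
      next
        case False
        then have "Pair xd -` Q = {}" by (auto simp: Q_def xd)
        then show ?thesis using False by (simp add: xd)
      qed
    qed
    also have "\<dots> = ennreal (\<alpha> ^ (k - 1)) * emeasure (circle_measure \<Otimes>\<^sub>M circle_measure) (UNIV \<times> E)"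
      by (rule nn_integral_cmult_indicator) (use E in \<open>auto intro!: pair_measureI\<close>)
    also have "emeasure (circle_measure \<Otimes>\<^sub>M circle_measure) (UNIV \<times> E) = emeasure circle_measure E"
      using E circle_prob.emeasure_space_1 by (subst circle_prob.emeasure_pair_measure_Times) auto
    finally have "emeasure ?P Q = ennreal (\<alpha> ^ (k - 1) * measure circle_measure E)"
      using g(4) by (simp add: circle_prob.emeasure_eq_measure ennreal_mult)
    then show ?thesis using g(4) by (simp add: measure_def)
  qed
  finally show ?thesis .
qed

text \<open>The exceptional differences: those for which two of the k terms of a progression lie
  closer than \<eta> on the circle.\<close>

definition near_torsion :: "nat \<Rightarrow> real \<Rightarrow> circle set" where
  "near_torsion k \<eta> = {d. \<exists>q\<in>{1..<k}. \<exists>z::int. \<bar>real q * crep d - of_int z\<bar> < \<eta>}"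

lemma near_torsion_measurable: "near_torsion k \<eta> \<in> sets borel"
  unfolding near_torsion_def by measurable

text \<open>For fixed q the set is covered by q + 1 intervals of length 2 \<eta> / q around the
  points z / q, where \<eta> \<le> 1 confines z to 0, ..., q. As q + 1 \<le> 2 q, each q contributes
  at most 4 \<eta>.\<close>

lemma measure_near_torsion_le:
  assumes "0 < \<eta>" "\<eta> \<le> 1"
  shows "measure circle_measure (near_torsion k \<eta>) \<le> 4 * real k * \<eta>"
proof -
  let ?I = "\<lambda>q z. {(real z - \<eta>) / real q..(real z + \<eta>) / real q}"
  have "emeasure circle_measure (near_torsion k \<eta>)
     = emeasure lborel ({0..<1} \<inter> circle_of -` near_torsion k \<eta>)"
    by (rule emeasure_circle_measure[OF near_torsion_measurable])
  also have "\<dots> \<le> emeasure lborel (\<Union>q\<in>{1..<k}. \<Union>z\<in>{..q}. ?I q z)"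
  proof (rule emeasure_mono)
    show "{0..<1} \<inter> circle_of -` near_torsion k \<eta> \<subseteq> (\<Union>q\<in>{1..<k}. \<Union>z\<in>{..q}. ?I q z)"
    proof
      fix t assume "t \<in> {0..<1} \<inter> circle_of -` near_torsion k \<eta>"
      then obtain q z where t: "0 \<le> t" "t < 1" and q: "q \<in> {1..<k}" and z: "\<bar>real q * t - of_int z\<bar> < \<eta>"
        by (auto simp: near_torsion_def frac_eq)
      have "0 \<le> real q * t" "real q * t < real q" using t q by auto
      then have "- 1 < real_of_int z" "real_of_int z < real q + 1" using z assms by linarith+
      then have "0 \<le> z" "z \<le> int q" by linarith+
      moreover from this have "t \<in> ?I q (nat z)" using z q by (auto simp: field_simps)
      ultimately show "t \<in> (\<Union>q\<in>{1..<k}. \<Union>z\<in>{..q}. ?I q z)" using q by (intro UN_I[of q] UN_I[of "nat z"]) auto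
    qed
  qed auto
  also have "\<dots> \<le> (\<Sum>q\<in>{1..<k}. emeasure lborel (\<Union>z\<in>{..q}. ?I q z))"
    by (rule emeasure_subadditive_finite) auto
  also have "\<dots> \<le> (\<Sum>q\<in>{1..<k}. \<Sum>z\<in>{..q}. emeasure lborel (?I q z))"
    by (intro sum_mono emeasure_subadditive_finite) auto
  also have "\<dots> = (\<Sum>q\<in>{1..<k}. \<Sum>z\<in>{..q}. ennreal (2 * \<eta> / real q))"
    using assms by (intro sum.cong refl) (subst emeasure_lborel_Icc, auto simp: divide_right_mono diff_divide_distrib add_divide_distrib)
  also have "\<dots> = ennreal (\<Sum>q\<in>{1..<k}. real (Suc q) * (2 * \<eta> / real q))"
  proof -
    have "(\<Sum>z\<in>{..q}. ennreal (2 * \<eta> / real q)) = ennreal (real (Suc q) * (2 * \<eta> / real q))" for q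
      using assms by (subst sum_ennreal) auto
    then show ?thesis using assms by (subst sum_ennreal[symmetric]) auto
  qed
  also have "\<dots> \<le> ennreal (\<Sum>q\<in>{1..<k}. 4 * \<eta>)"
    using assms by (intro ennreal_leI sum_mono) (auto simp: field_simps)
  also have "\<dots> \<le> ennreal (4 * real k * \<eta>)" using assms by (intro ennreal_leI) (auto simp: of_nat_diff algebra_simps mult_right_mono)
  finally show ?thesis using assms by (simp add: circle_prob.emeasure_eq_measure)
qed

section \<open>Colorings and digits\<close>

text \<open>
  Each of the at most \<open>card I * card C ^ (card I - 1)\<close> assignments that use the last color with
  nonzero total coefficient forbids a single value for its point.
\<close>

lemma greedy_points:
  fixes a :: "'i \<Rightarrow> int"
  assumes I: "finite I" and C: "finite C"
  shows "\<exists>p :: 'c \<Rightarrow> nat. (\<forall>c\<in>C. p c \<le> card I * card C ^ (card I - 1)) \<and>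
    (\<forall>f\<in>I \<rightarrow> C. (\<exists>c\<in>C. (\<Sum>i | i \<in> I \<and> f i = c. a i) \<noteq> 0) \<longrightarrow> (\<Sum>i\<in>I. a i * int (p (f i))) \<noteq> 0)"
  using C
proof (induction C rule: finite_induct)
  case empty
  then show ?case by simp
next
  case (insert x C)
  then obtain p where p: "\<And>c. c \<in> C \<Longrightarrow> p c \<le> card I * card C ^ (card I - 1)"
    "\<And>f c. f \<in> I \<rightarrow> C \<Longrightarrow> c \<in> C \<Longrightarrow> (\<Sum>i | i \<in> I \<and> f i = c. a i) \<noteq> 0 \<Longrightarrow> (\<Sum>i\<in>I. a i * int (p (f i))) \<noteq> 0"
    by blast
  define n where "n = card I * card (insert x C) ^ (card I - 1)"
  \<comment> \<open>The assignments that use the new color x. Their number is bounded by choosing an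
    index that is sent to x and then the other values freely.\<close>
  define G where "G = {f \<in> I \<rightarrow>\<^sub>E insert x C. \<exists>i\<in>I. f i = x}"
  define coef where "coef f = (\<Sum>i | i \<in> I \<and> f i = x. a i)" for f
  define rest where "rest f = (\<Sum>i | i \<in> I \<and> f i \<noteq> x. a i * int (p (f i)))" for f
  have split: "(\<Sum>i\<in>I. a i * g i) = (\<Sum>i | i \<in> I \<and> f i = x. a i * g i) + (\<Sum>i | i \<in> I \<and> f i \<noteq> x. a i * g i)" for f g
    using I by (subst sum.union_disjoint[symmetric]) (auto intro!: sum.cong)
  have "card G \<le> n"
  proof -
    have sub: "G \<subseteq> (\<Union>i\<in>I. \<Pi>\<^sub>E j\<in>I. if j = i then {x} else insert x C)"
    proof
      fix f assume "f \<in> G"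
      then obtain i where i: "i \<in> I" "f i = x" "f \<in> I \<rightarrow>\<^sub>E insert x C" by (auto simp: G_def)
      then have "f \<in> (\<Pi>\<^sub>E j\<in>I. if j = i then {x} else insert x C)" by (auto simp: PiE_iff)
      with i(1) show "f \<in> (\<Union>i\<in>I. \<Pi>\<^sub>E j\<in>I. if j = i then {x} else insert x C)" by blast
    qed
    have "card G \<le> card (\<Union>i\<in>I. \<Pi>\<^sub>E j\<in>I. if j = i then {x} else insert x C)"
      using I insert.hyps by (intro card_mono[OF _ sub] finite_UN_I finite_PiE) auto
    also have "\<dots> \<le> (\<Sum>i\<in>I. card (\<Pi>\<^sub>E j\<in>I. if j = i then {x} else insert x C))"
      using I by (rule card_UN_le)
    also have "\<dots> = (\<Sum>i\<in>I. card (insert x C) ^ (card I - 1))"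
    proof (rule sum.cong)
      fix i assume "i \<in> I"
      then have "card (\<Pi>\<^sub>E j\<in>I. if j = i then {x} else insert x C) = (\<Prod>j\<in>I - {i}. card (insert x C))"
        using I by (simp add: card_PiE prod.remove[of I i])
      then show "card (\<Pi>\<^sub>E j\<in>I. if j = i then {x} else insert x C) = card (insert x C) ^ (card I - 1)"
        using I \<open>i \<in> I\<close> by (simp del: card_insert_disjoint)
    qed simp
    finally show ?thesis by (simp add: n_def)
  qed
  have "finite G" using I insert.hyps
    by (intro finite_subset[of G "I \<rightarrow>\<^sub>E insert x C"] finite_PiE) (auto simp: G_def)
  have "\<not> {..n} \<subseteq> (\<lambda>f. nat (- rest f div coef f)) ` G"
  proof
    assume "{..n} \<subseteq> (\<lambda>f. nat (- rest f div coef f)) ` G"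
    then have "card {..n} \<le> card ((\<lambda>f. nat (- rest f div coef f)) ` G)"
      using \<open>finite G\<close> by (intro card_mono) auto
    also have "\<dots> \<le> card G" using \<open>finite G\<close> by (rule card_image_le)
    finally show False using \<open>card G \<le> n\<close> by simp
  qed
  then obtain v where v: "v \<le> n" "v \<notin> (\<lambda>f. nat (- rest f div coef f)) ` G" by auto
  show ?case
  proof (intro exI[of _ "p(x := v)"] conjI ballI impI)
    fix c assume "c \<in> insert x C"
    moreover have "card I * card C ^ (card I - 1) \<le> n"
      unfolding n_def using insert.hyps by (intro mult_left_mono power_mono) auto
    ultimately have "(p(x := v)) c \<le> n" using v(1) p(1)[of c] by auto
    then show "(p(x := v)) c \<le> card I * card (insert x C) ^ (card I - 1)" by (simp only: n_def)
  next
    fix f assume f: "f \<in> I \<rightarrow> insert x C" and "\<exists>c\<in>insert x C. (\<Sum>i | i \<in> I \<and> f i = c. a i) \<noteq> 0"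
    then obtain c where c: "c \<in> insert x C" "(\<Sum>i | i \<in> I \<and> f i = c. a i) \<noteq> 0" by blast
    have total: "(\<Sum>i\<in>I. a i * int ((p(x := v)) (f i))) = coef f * int v + rest f"
      unfolding split[of _ f] coef_def rest_def sum_distrib_right
      by (intro arg_cong2[where f = "(+)"] sum.cong) auto
    show "(\<Sum>i\<in>I. a i * int ((p(x := v)) (f i))) \<noteq> 0"
    proof (cases "coef f = 0")
      case True
      then have "c \<in> C" using c by (auto simp: coef_def)
      have "c \<noteq> x" using True c by (auto simp: coef_def)
      \<comment> \<open>Since x has total coefficient 0, recoloring x as c changes neither the total
        coefficient of c nor the value of the form, and the induction hypothesis applies.\<close>
      define f' where "f' i = (if f i = x then c else f i)" for i
      have "f' \<in> I \<rightarrow> C" using f \<open>c \<in> C\<close> by (auto simp: f'_def)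
      moreover have "(\<Sum>i | i \<in> I \<and> f' i = c. a i) = coef f + (\<Sum>i | i \<in> I \<and> f i = c. a i)"
        unfolding coef_def using I \<open>c \<noteq> x\<close>
        by (subst sum.union_disjoint[symmetric]) (auto simp: f'_def intro!: sum.cong)
      ultimately have "(\<Sum>i\<in>I. a i * int (p (f' i))) \<noteq> 0" using p(2) c True \<open>c \<in> C\<close> by simp
      moreover have "(\<Sum>i\<in>I. a i * int (p (f' i))) = coef f * int (p c) + rest f"
        unfolding split[of _ f] coef_def rest_def sum_distrib_right
        by (intro arg_cong2[where f = "(+)"] sum.cong) (auto simp: f'_def)
      ultimately show ?thesis using True total by simp
    next
      case False
      then have "{i. i \<in> I \<and> f i = x} \<noteq> {}" unfolding coef_def by (intro notI) simp
      then obtain i where "i \<in> I" "f i = x" by blast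
      with f have "restrict f I \<in> G" by (auto simp: G_def)
      then have *: "v \<noteq> nat (- rest (restrict f I) div coef (restrict f I))" using v(2) by blast
      have [simp]: "rest (restrict f I) = rest f" "coef (restrict f I) = coef f"
        unfolding rest_def coef_def by (auto intro!: sum.cong)
      have "coef f * int v + rest f \<noteq> 0"
      proof
        assume "coef f * int v + rest f = 0"
        then have "- rest f = int v * coef f" by (simp add: algebra_simps)
        then have "- rest f div coef f = int v" using False by simp
        then show False using * by simp
      qed
      then show ?thesis using total by simp
    qed
  qed
qed

section \<open>Asymmetric colorings and their powers\<close>

definition asym_coloring :: "nat \<Rightarrow> nat \<Rightarrow> nat \<Rightarrow> (nat \<Rightarrow> nat) \<Rightarrow> bool" where
  "asym_coloring k r N c \<longleftrightarrow> (\<forall>n<N. c n < r) \<and>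
     (\<forall>n D. \<not> int N dvd D \<longrightarrow> (\<exists>i\<in>{1..k div 2}.
        c (nat ((n + (int i - 1) * D) mod int N)) \<noteq> c (nat ((n + (int k - int i) * D) mod int N))))"

lemma asym_coloringI:
  assumes "N \<ge> 1" "c \<in> {..<N} \<rightarrow> {..<r}"
    and c: "\<not> (\<exists>n\<in>{..<N}. \<exists>d\<in>{..<N}. d \<noteq> 0 \<and> symmetrically_colored N k c n d)"
  shows "asym_coloring k r N c"
  unfolding asym_coloring_def
proof (intro conjI allI impI)
  fix n D :: int assume D: "\<not> int N dvd D"
  define n' where "n' = nat (n mod int N)"
  define d' where "d' = nat (D mod int N)"
  have n': "int n' = n mod int N" and d': "int d' = D mod int N" using assms(1) by (simp_all add: n'_def d'_def)
  have "d' \<noteq> 0" using d' D by (auto simp: dvd_eq_mod_eq_0)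
  moreover have "int n' < int N" "int d' < int N" unfolding n' d' using assms(1) by simp_all
  then have "n' < N" "d' < N" by simp_all
  ultimately have "\<not> symmetrically_colored N k c n' d'" using c by blast
  then obtain i where i: "i \<in> {1..k div 2}" "c ((n' + (i - 1) * d') mod N) \<noteq> c ((n' + (k - i) * d') mod N)"
    unfolding symmetrically_colored_def by blast
  have "(n' + j * d') mod N = nat ((n + int j * D) mod int N)" for j
  proof -
    have "int ((n' + j * d') mod N) = (n mod int N + int j * (D mod int N)) mod int N"
      by (simp add: zmod_int n' d')
    also have "\<dots> = (n + int j * D) mod int N" by (metis mod_add_cong mod_mod_trivial mod_mult_right_eq)
    finally have "int ((n' + j * d') mod N) = (n + int j * D) mod int N" .
    then show ?thesis by (metis nat_int)
  qed
  then show "\<exists>i\<in>{1..k div 2}. c (nat ((n + (int i - 1) * D) mod int N)) \<noteq> c (nat ((n + (int k - int i) * D) mod int N))"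
    using i by (intro bexI[of _ i]) (auto simp: of_nat_diff)
qed (use assms(2) in auto)

text \<open>A progression modulo \<open>N * M\<close> is either nonconstant modulo \<open>N\<close> or has quotients by \<open>N\<close>
  forming a progression modulo \<open>M\<close>.\<close>

lemma asym_coloring_mult:
  assumes c: "asym_coloring k r N c" "N \<ge> 1" and e: "asym_coloring k s M e" "M \<ge> 1"
  shows "asym_coloring k (r * s) (N * M) (\<lambda>n. c (n mod N) + r * e (n div N))"
  unfolding asym_coloring_def
proof (intro conjI allI impI)
  fix n assume "n < N * M"
  then have "c (n mod N) < r" "e (n div N) < s"
    using c e by (auto simp: asym_coloring_def less_mult_imp_div_less mult.commute)
  have "c (n mod N) + r * e (n div N) < r * (e (n div N) + 1)" using \<open>c (n mod N) < r\<close> by simp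
  also have "\<dots> \<le> r * s" using \<open>e (n div N) < s\<close> by (intro mult_left_mono) auto
  finally show "c (n mod N) + r * e (n div N) < r * s" .
next
  fix n D :: int assume D: "\<not> int (N * M) dvd D"
  define t where "t j = nat ((n + j * D) mod int (N * M))" for j
  have t: "int (t j) = (n + j * D) mod (int N * int M)" for j using c(2) e(2) by (simp add: t_def)
  have t_mod: "t j mod N = nat ((n + j * D) mod int N)" for j
  proof -
    have "int (t j mod N) = (n + j * D) mod int N" by (simp add: zmod_int t mod_mod_cancel)
    then show ?thesis by (metis nat_int)
  qed
  have t_div: "t j div N = nat ((n + j * D) div int N mod int M)" for j
  proof -
    have "int (t j div N) = (n + j * D) div int N mod int M"
      using c(2) by (simp add: zdiv_int t zmod_zmult2_eq)
    then show ?thesis by (metis nat_int)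
  qed
  have lt: "c (t j mod N) < r" for j using c by (simp add: asym_coloring_def)
  have "\<exists>i\<in>{1..k div 2}. c (t (int i - 1) mod N) \<noteq> c (t (int k - int i) mod N) \<or>
      e (t (int i - 1) div N) \<noteq> e (t (int k - int i) div N)"
  proof (cases "int N dvd D")
    case False
    then show ?thesis using c(1) unfolding asym_coloring_def t_mod by blast
  next
    case True
    then obtain D' where D': "D = int N * D'" by auto
    then have "\<not> int M dvd D'" using D by auto
    moreover have "(n + j * D) div int N = n div int N + j * D'" for j
    proof -
      have "n + j * D = n + int N * (j * D')" by (simp add: D')
      then show ?thesis using c(2) by (simp only:) simp
    qed
    ultimately show ?thesis using e(1) unfolding asym_coloring_def t_div by simp blast
  qed
  then obtain i where i: "i \<in> {1..k div 2}" "c (t (int i - 1) mod N) \<noteq> c (t (int k - int i) mod N) \<or>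
      e (t (int i - 1) div N) \<noteq> e (t (int k - int i) div N)" by blast
  \<comment> \<open>The two colors are recovered from their combination as remainder and quotient by
    r.\<close>
  have inj: "a = b \<and> a' = b'" if "a + r * a' = b + r * b'" "a < r" "b < r" for a b a' b'
  proof -
    have "(a + r * a') mod r = (b + r * b') mod r" "(a + r * a') div r = (b + r * b') div r" using that(1) by simp_all
    then show ?thesis using that(2,3) by simp
  qed
  show "\<exists>i\<in>{1..k div 2}.
       c (nat ((n + (int i - 1) * D) mod int (N * M)) mod N) + r * e (nat ((n + (int i - 1) * D) mod int (N * M)) div N)
     \<noteq> c (nat ((n + (int k - int i) * D) mod int (N * M)) mod N) + r * e (nat ((n + (int k - int i) * D) mod int (N * M)) div N)"
    using i(1)
  proof (intro bexI notI)
    assume "c (nat ((n + (int i - 1) * D) mod int (N * M)) mod N) + r * e (nat ((n + (int i - 1) * D) mod int (N * M)) div N)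
      = c (nat ((n + (int k - int i) * D) mod int (N * M)) mod N) + r * e (nat ((n + (int k - int i) * D) mod int (N * M)) div N)"
    from inj[OF this[folded t_def] lt lt] i(2) show False by simp
  qed
qed

text \<open>Passing to powers keeps the ratio of the logarithms of N and r, while a constant factor
  lost per digit becomes negligible against r^s.\<close>

lemma asym_coloring_power:
  assumes "asym_coloring k r N c" "N \<ge> 1"
  shows "\<exists>e. asym_coloring k (r ^ s) (N ^ s) e"
proof (induction s)
  case 0
  have "asym_coloring k (r ^ 0) (N ^ 0) (\<lambda>_. 0)" by (simp add: asym_coloring_def)
  then show ?case by blast
next
  case (Suc s)
  then obtain e where "asym_coloring k (r ^ s) (N ^ s) e" by blast
  from asym_coloring_mult[OF assms this] assms(2) show ?case by auto
qed

section \<open>Digits and the coloring of the line\<close>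

definition digit :: "nat \<Rightarrow> nat \<Rightarrow> real \<Rightarrow> nat" where
  "digit B j x = nat \<lfloor>real B * frac (real B ^ j * x)\<rfloor>"

text \<open>The first list has m + 1 entries for m digits, because digit j is determined by the
  fractional parts at the scales j and j + 1.\<close>

definition digit_color :: "nat \<Rightarrow> nat \<Rightarrow> nat \<Rightarrow> (nat \<Rightarrow> nat) \<Rightarrow> real \<Rightarrow> nat list \<times> nat list \<times> nat" where
  "digit_color K B m c x =
     (map (\<lambda>j. nat \<lfloor>real K * frac (real B ^ j * x)\<rfloor>) [0..<Suc m],
      map (\<lambda>j. c (digit B j x)) [0..<m],
      \<Sum>j<m. (digit B j x)\<^sup>2)"

text \<open>Multiplication by B moves one digit in front of the point. This recurrence carries
  linear relations from fractional parts over to digits.\<close>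

lemma frac_power_digit:
  "real B * frac (real B ^ j * x) = real (digit B j x) + frac (real B ^ Suc j * x)"
proof -
  let ?y = "real B * frac (real B ^ j * x)"
  have "?y = real B ^ Suc j * x - of_int (int B * \<lfloor>real B ^ j * x\<rfloor>)"
    by (simp add: frac_def algebra_simps)
  then have "frac ?y = frac (real B ^ Suc j * x)"
    by (simp only: frac_def floor_diff_of_int of_int_diff)
  moreover have "real (digit B j x) = of_int \<lfloor>?y\<rfloor>" by (simp add: digit_def)
  ultimately show ?thesis by (metis add.commute diff_add_cancel frac_def)
qed

lemma digit_less:
  assumes "B \<ge> 1" shows "digit B j x < B"
proof -
  have "real B * frac (real B ^ j * x) < real B * 1"
    using assms by (intro mult_strict_left_mono frac_lt_1) auto
  then show ?thesis using frac_power_digit[of B j x] frac_ge_0[of "real B ^ Suc j * x"] by linarith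
qed

lemma digit_color_add_int: "digit_color K B m c (x + of_int n) = digit_color K B m c x"
proof -
  have "frac (real B ^ j * (x + of_int n)) = frac (real B ^ j * x)" for j
  proof -
    have "real B ^ j * (x + of_int n) = real B ^ j * x + of_int (int B ^ j * n)" by (simp add: algebra_simps)
    then show ?thesis by (simp only: frac_add_of_int_right)
  qed
  then show ?thesis by (simp add: digit_color_def digit_def)
qed

lemma digit_color_in:
  assumes "K \<ge> 1" "B \<ge> 1" "\<forall>n<B. c n < r"
  shows "digit_color K B m c x \<in> {xs. set xs \<subseteq> {..<K} \<and> length xs = Suc m} \<times>
    {xs. set xs \<subseteq> {..<r} \<and> length xs = m} \<times> {..m * B\<^sup>2}"
proof -
  have "nat \<lfloor>real K * frac y\<rfloor> < K" for y
  proof -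
    have "real K * frac y < real K * 1" using assms(1) by (intro mult_strict_left_mono frac_lt_1) auto
    then show ?thesis using frac_ge_0[of y] assms(1) by (simp add: nat_less_iff floor_less_iff)
  qed
  moreover have "(\<Sum>j<m. (digit B j x)\<^sup>2) \<le> (\<Sum>j<m. B\<^sup>2)"
    using digit_less[OF assms(2)] by (intro sum_mono power_mono) (auto intro: less_imp_le)
  ultimately show ?thesis using digit_less[OF assms(2)] assms(3) by (auto simp: digit_color_def)
qed

lemma digit_color_eqD:
  assumes "digit_color K B m c x = digit_color K B m c y" "K \<ge> 1"
  shows "j \<le> m \<Longrightarrow> \<bar>frac (real B ^ j * x) - frac (real B ^ j * y)\<bar> < 1 / real K"
    and "j < m \<Longrightarrow> c (digit B j x) = c (digit B j y)"
    and "(\<Sum>j<m. (digit B j x)\<^sup>2) = (\<Sum>j<m. (digit B j y)\<^sup>2)"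
proof -
  assume "j \<le> m"
  then have "nat \<lfloor>real K * frac (real B ^ j * x)\<rfloor> = nat \<lfloor>real K * frac (real B ^ j * y)\<rfloor>"
    using assms(1) unfolding digit_color_def prod.inject map_eq_conv set_upt by (auto simp: less_Suc_eq_le)
  then have "\<lfloor>real K * frac (real B ^ j * x)\<rfloor> = \<lfloor>real K * frac (real B ^ j * y)\<rfloor>"
    by (simp add: eq_nat_nat_iff)
  then have "\<bar>real K * frac (real B ^ j * x) - real K * frac (real B ^ j * y)\<bar> < 1" by linarith
  then have "real K * \<bar>frac (real B ^ j * x) - frac (real B ^ j * y)\<bar> < 1"
    by (simp add: abs_mult flip: right_diff_distrib)
  then show "\<bar>frac (real B ^ j * x) - frac (real B ^ j * y)\<bar> < 1 / real K"
    using assms(2) by (simp add: field_simps)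
next
  show "j < m \<Longrightarrow> c (digit B j x) = c (digit B j y)"
    and "(\<Sum>j<m. (digit B j x)\<^sup>2) = (\<Sum>j<m. (digit B j y)\<^sup>2)"
    using assms(1) unfolding digit_color_def prod.inject map_eq_conv set_upt by auto
qed

text \<open>Each common digit divides the difference by B, and after m digits what is left is the
  difference of two numbers in [0, 1).\<close>

lemma digits_eq_imp_close:
  assumes "B \<ge> 1" "\<And>j. j < m \<Longrightarrow> digit B j x = digit B j y"
  shows "\<bar>frac x - frac y\<bar> < 1 / real B ^ m"
proof -
  have "frac x - frac y = (frac (real B ^ n * x) - frac (real B ^ n * y)) / real B ^ n" if "n \<le> m" for n
    using that
  proof (induction n)
    case (Suc n)
    then have "digit B n x = digit B n y" using assms(2) by simp
    then have "real B * (frac (real B ^ n * x) - frac (real B ^ n * y)) = frac (real B ^ Suc n * x) - frac (real B ^ Suc n * y)"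
      using frac_power_digit[of B n x] frac_power_digit[of B n y] by (simp add: algebra_simps)
    then have "frac (real B ^ n * x) - frac (real B ^ n * y) = (frac (real B ^ Suc n * x) - frac (real B ^ Suc n * y)) / real B"
      using assms(1) by (simp add: field_simps)
    then show ?case using Suc by (simp add: mult.commute)
  qed simp
  from this[of m] have "\<bar>frac x - frac y\<bar> = \<bar>frac (real B ^ m * x) - frac (real B ^ m * y)\<bar> / real B ^ m"
    by (simp add: abs_divide)
  also have "\<bar>frac (real B ^ m * x) - frac (real B ^ m * y)\<bar> < 1"
    using frac_lt_1[of "real B ^ m * x"] frac_lt_1[of "real B ^ m * y"]
      frac_ge_0[of "real B ^ m * x"] frac_ge_0[of "real B ^ m * y"] by linarith
  then have "\<bar>frac (real B ^ m * x) - frac (real B ^ m * y)\<bar> / real B ^ m < 1 / real B ^ m"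
    using assms(1) by (intro divide_strict_right_mono) auto
  finally show ?thesis .
qed

text \<open>Behrend's argument: by strict convexity of the square, a nontrivial convex relation is
  incompatible with equal sums of squares of digits, and equal leading parts of all the
  fractional parts exclude carries.\<close>

lemma digit_color_triple:
  fixes u v w :: real and l n :: nat
  assumes rel: "real l * u + real n * v - real (l + n) * w \<in> \<int>"
    and l: "l \<ge> 1" "n \<ge> 1" "l + n \<le> K" and B: "B \<ge> 1"
    and eq: "digit_color K B m c u = digit_color K B m c w" "digit_color K B m c v = digit_color K B m c w"
  shows "\<bar>frac u - frac w\<bar> < 1 / real B ^ m"
proof (rule digits_eq_imp_close[OF B])
  have K: "K \<ge> 1" using l by simp
  \<comment> \<open>At every scale the relation holds modulo 1. Its error is a sum of l + n \<le> K
    terms below 1 / K in absolute value, so it is an integer of absolute value below 1.\<close>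
  have U: "real l * frac (real B ^ j * u) + real n * frac (real B ^ j * v) = real (l + n) * frac (real B ^ j * w)"
    if "j \<le> m" for j
  proof -
    let ?y = "real l * frac (real B ^ j * u) + real n * frac (real B ^ j * v) - real (l + n) * frac (real B ^ j * w)"
    obtain z where z: "real l * u + real n * v - real (l + n) * w = of_int z" using rel by (elim Ints_cases)
    have "?y = real B ^ j * (real l * u + real n * v - real (l + n) * w)
        - of_int (int l * \<lfloor>real B ^ j * u\<rfloor> + int n * \<lfloor>real B ^ j * v\<rfloor> - int (l + n) * \<lfloor>real B ^ j * w\<rfloor>)"
      by (simp add: frac_def algebra_simps)
    also have "\<dots> = of_int (int B ^ j * z - (int l * \<lfloor>real B ^ j * u\<rfloor> + int n * \<lfloor>real B ^ j * v\<rfloor> - int (l + n) * \<lfloor>real B ^ j * w\<rfloor>))"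
      by (simp only: z of_int_diff of_int_mult of_int_power of_int_of_nat_eq)
    finally have "?y \<in> \<int>" by (metis Ints_of_int)
    moreover have "\<bar>?y\<bar> < 1"
    proof -
      have 1: "real l * \<bar>frac (real B ^ j * u) - frac (real B ^ j * w)\<bar> < real l * (1 / real K)"
        "real n * \<bar>frac (real B ^ j * v) - frac (real B ^ j * w)\<bar> < real n * (1 / real K)"
        using l digit_color_eqD(1)[OF eq(1) K that] digit_color_eqD(1)[OF eq(2) K that]
        by (auto intro!: mult_strict_left_mono simp del: times_divide_eq_right)
      have "?y = real l * (frac (real B ^ j * u) - frac (real B ^ j * w)) + real n * (frac (real B ^ j * v) - frac (real B ^ j * w))"
        by (simp add: algebra_simps)
      also have "\<bar>\<dots>\<bar> \<le> real l * \<bar>frac (real B ^ j * u) - frac (real B ^ j * w)\<bar> + real n * \<bar>frac (real B ^ j * v) - frac (real B ^ j * w)\<bar>"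
        by (rule order_trans[OF abs_triangle_ineq]) (simp add: abs_mult)
      also have "\<dots> < real l * (1 / real K) + real n * (1 / real K)" using 1 by linarith
      also have "\<dots> = real (l + n) / real K" by (simp add: add_divide_distrib)
      also have "\<dots> \<le> 1" using l by simp
      finally show ?thesis .
    qed
    ultimately show ?thesis using Ints_nonzero_abs_less1[of ?y] by force
  qed
  let ?d = "\<lambda>j x. real (digit B j x)"
  \<comment> \<open>Subtracting the relation at scale j + 1 from B times the one at scale j leaves
    the digits.\<close>
  have D: "real l * ?d j u + real n * ?d j v = real (l + n) * ?d j w" if "j < m" for j
  proof -
    have "real l * (real B * frac (real B ^ j * u)) + real n * (real B * frac (real B ^ j * v))
        = real B * (real (l + n) * frac (real B ^ j * w))"
      using arg_cong[OF U[of j], of "(*) (real B)"] that by (simp only: less_imp_le algebra_simps)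
    moreover have "real l * frac (real B ^ Suc j * u) + real n * frac (real B ^ Suc j * v) = real (l + n) * frac (real B ^ Suc j * w)"
      using U[of "Suc j"] that by simp
    ultimately show ?thesis unfolding frac_power_digit mult.left_commute[of "real B"] distrib_left by linarith
  qed
  have sq: "(\<Sum>j<m. (?d j u)\<^sup>2) = (\<Sum>j<m. (?d j w)\<^sup>2)" "(\<Sum>j<m. (?d j v)\<^sup>2) = (\<Sum>j<m. (?d j w)\<^sup>2)"
    using digit_color_eqD(3)[OF eq(1) K] digit_color_eqD(3)[OF eq(2) K]
    by (simp_all flip: of_nat_power of_nat_sum)
  \<comment> \<open>Expanding the squares, the mixed terms are evaluated by \<open>D\<close>; the
    result vanishes because all three sums of squares agree.\<close>
  have "(\<Sum>j<m. real l * (?d j u - ?d j w)\<^sup>2 + real n * (?d j v - ?d j w)\<^sup>2)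
    = (\<Sum>j<m. real l * (?d j u)\<^sup>2 + real n * (?d j v)\<^sup>2 - real (l + n) * (?d j w)\<^sup>2)"
  proof (intro sum.cong refl)
    fix j assume "j \<in> {..<m}"
    then have "real l * ?d j u * ?d j w + real n * ?d j v * ?d j w = real (l + n) * ?d j w * ?d j w"
      using D[of j] by (simp flip: D distrib_right)
    then show "real l * (?d j u - ?d j w)\<^sup>2 + real n * (?d j v - ?d j w)\<^sup>2
      = real l * (?d j u)\<^sup>2 + real n * (?d j v)\<^sup>2 - real (l + n) * (?d j w)\<^sup>2"
      by (simp add: power2_eq_square algebra_simps)
  qed
  also have "\<dots> = real l * (\<Sum>j<m. (?d j u)\<^sup>2) + real n * (\<Sum>j<m. (?d j v)\<^sup>2) - real (l + n) * (\<Sum>j<m. (?d j w)\<^sup>2)"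
    by (simp add: sum.distrib sum_subtractf sum_distrib_left)
  also have "\<dots> = 0" unfolding sq by (simp add: algebra_simps)
  finally have "\<forall>j\<in>{..<m}. real l * (?d j u - ?d j w)\<^sup>2 + real n * (?d j v - ?d j w)\<^sup>2 = 0"
    by (subst (asm) sum_nonneg_eq_0_iff) auto
  then show "digit B j u = digit B j w" if "j < m" for j
    using that l by (simp add: add_nonneg_eq_0_iff)
qed

text \<open>Mirror symmetric colors keep the fractional parts at each scale from wrapping around, so
  they form a progression of reals, and therefore so do the digits. A nonconstant progression of
  digits would be symmetrically colored modulo B. Hence the first two terms agree in m
  digits.\<close>

lemma digit_color_symmetric:
  fixes x d :: real and c :: "nat \<Rightarrow> nat"
  defines "X \<equiv> \<lambda>i::nat. x + (real i - 1) * d"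
  assumes k: "k \<ge> 4" "even k" and B: "B \<ge> 1" and c: "asym_coloring k r B c"
    and sym: "\<And>i. i \<in> {1..k} \<Longrightarrow> digit_color k B m c (X i) = digit_color k B m c (X (k + 1 - i))"
  shows "\<exists>z::int. \<bar>d - of_int z\<bar> < 1 / real B ^ m"
proof -
  let ?U = "\<lambda>j i. frac (real B ^ j * X i)"
  define h where "h = k div 2"
  have h: "k = 2 * h" "h \<ge> 2" using k by (auto simp: h_def)
  \<comment> \<open>The two middle indices mirror each other, so this candidate for the common
    difference is below 1 / k in absolute value.\<close>
  define \<delta> where "\<delta> j = ?U j (Suc h) - ?U j h" for j
  have ap: "?U j i = ?U j 1 + (real i - 1) * \<delta> j" if j: "j \<le> m" and i: "i \<in> {1..k}" for i j
  proof -
    have int: "?U j i - ?U j 1 - (real i - 1) * \<delta> j \<in> \<int>" if "i \<in> {1..k}" for i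
    proof -
      have "?U j i - ?U j 1 - (real i - 1) * \<delta> j
        = of_int (\<lfloor>real B ^ j * X 1\<rfloor> - \<lfloor>real B ^ j * X i\<rfloor> + (int i - 1) * (\<lfloor>real B ^ j * X (Suc h)\<rfloor> - \<lfloor>real B ^ j * X h\<rfloor>))"
        by (simp add: frac_def \<delta>_def X_def algebra_simps)
      then show ?thesis by (metis Ints_of_int)
    qed
    have close: "\<bar>?U j i - ?U j (k + 1 - i)\<bar> < 1 / real k" if "i \<in> {1..k}" for i
      using digit_color_eqD(1)[OF sym[OF that] _ j] k by simp
    have "\<bar>\<delta> j\<bar> < 1 / real k" using close[of "Suc h"] h by (simp add: \<delta>_def)
    then have "(real k - 1) * \<bar>\<delta> j\<bar> < (real k - 1) * (1 / real k)" using k by (intro mult_strict_left_mono) auto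
    moreover have "\<bar>(real k - 1) * \<delta> j\<bar> = (real k - 1) * \<bar>\<delta> j\<bar>" using k by (simp add: abs_mult)
    moreover have "\<bar>?U j k - ?U j 1\<bar> < 1 / real k" using close[of k] k by simp
    moreover have "(real k - 1) * (1 / real k) + 1 / real k = 1" using k by (simp add: field_simps)
    \<comment> \<open>The outer indices mirror each other too, and the two errors add up to less
      than (k - 1) / k + 1 / k = 1.\<close>
    ultimately have "\<bar>?U j k - ?U j 1 - (real k - 1) * \<delta> j\<bar> < 1" by linarith
    then have last: "?U j k - ?U j 1 = (real k - 1) * \<delta> j" using int[of k] Ints_nonzero_abs_less1 k by fastforce
    \<comment> \<open>The predicted i-th term is a convex combination of the two outer fractional
      parts. It lies in [0, 1) and therefore differs from the true one, to which it is congruent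
      modulo 1, by less than 1.\<close>
    define \<theta> where "\<theta> = (real i - 1) / (real k - 1)"
    have \<theta>: "0 \<le> \<theta>" "\<theta> \<le> 1" using i k by (auto simp: \<theta>_def divide_simps)
    have "real i - 1 = \<theta> * (real k - 1)" using k by (simp add: \<theta>_def)
    then have "?U j 1 + (real i - 1) * \<delta> j = ?U j 1 + \<theta> * (?U j k - ?U j 1)" unfolding last by simp
    then have conv: "?U j 1 + (real i - 1) * \<delta> j = (1 - \<theta>) * ?U j 1 + \<theta> * ?U j k" by (simp add: algebra_simps)
    have "0 \<le> (1 - \<theta>) * ?U j 1 + \<theta> * ?U j k" using \<theta> by (intro add_nonneg_nonneg mult_nonneg_nonneg) auto
    moreover have "(1 - \<theta>) * ?U j 1 + \<theta> * ?U j k < 1" using \<theta> by (intro convex_bound_lt) (auto simp: frac_lt_1)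
    ultimately have "\<bar>?U j i - ?U j 1 - (real i - 1) * \<delta> j\<bar> < 1"
      using conv frac_lt_1[of "real B ^ j * X i"] frac_ge_0[of "real B ^ j * X i"] by linarith
    then show ?thesis using int[OF i] Ints_nonzero_abs_less1 by fastforce
  qed
  have "digit B j (X 2) = digit B j (X 1)" if j: "j < m" for j
  proof (rule ccontr)
    assume ne: "digit B j (X 2) \<noteq> digit B j (X 1)"
    define D where "D = int (digit B j (X 2)) - int (digit B j (X 1))"
    have dig: "real (digit B j (X i)) = real (digit B j (X 1)) + (real i - 1) * (real B * \<delta> j - \<delta> (Suc j))"
      if "i \<in> {1..k}" for i
    proof -
      have "real (digit B j (X i)) = real B * ?U j i - ?U (Suc j) i"
        and "real (digit B j (X 1)) = real B * ?U j 1 - ?U (Suc j) 1"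
        using frac_power_digit[of B j "X i"] frac_power_digit[of B j "X 1"] by linarith+
      moreover have "real B * ?U j i = real B * ?U j 1 + (real i - 1) * (real B * \<delta> j)"
        by (subst ap[of j i]) (use j that in \<open>auto simp: algebra_simps\<close>)
      moreover have "?U (Suc j) i = ?U (Suc j) 1 + (real i - 1) * \<delta> (Suc j)"
        using ap[of "Suc j" i] j that by simp
      ultimately show ?thesis unfolding right_diff_distrib by linarith
    qed
    have "real_of_int D = real B * \<delta> j - \<delta> (Suc j)" using dig[of 2] k by (simp add: D_def)
    then have dig': "int (digit B j (X i)) = int (digit B j (X 1)) + (int i - 1) * D" if "i \<in> {1..k}" for i
    proof -
      have "real_of_int (int (digit B j (X i))) = of_int (int (digit B j (X 1)) + (int i - 1) * D)"
        using dig[OF that] \<open>real_of_int D = _\<close> by simp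
      then show ?thesis by (simp only: of_int_eq_iff)
    qed
    have "\<bar>D\<bar> < int B" "D \<noteq> 0" using digit_less[OF B, of j "X 1"] digit_less[OF B, of j "X 2"] ne by (auto simp: D_def)
    then have "\<not> int B dvd D" using dvd_imp_le_int[of D "int B"] by auto
    then obtain i where i: "i \<in> {1..k div 2}"
      "c (nat ((int (digit B j (X 1)) + (int i - 1) * D) mod int B)) \<noteq> c (nat ((int (digit B j (X 1)) + (int k - int i) * D) mod int B))"
      using c unfolding asym_coloring_def by blast
    have i': "i \<in> {1..k}" "k + 1 - i \<in> {1..k}" using i k by auto
    have "int (k + 1 - i) - 1 = int k - int i" using i' by auto
    then have "c (digit B j (X i)) \<noteq> c (digit B j (X (k + 1 - i)))"
      using i(2) dig'[OF i'(1), symmetric] dig'[OF i'(2), symmetric] digit_less[OF B] by simp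
    then show False using digit_color_eqD(2)[OF sym[OF i'(1)] _ j] k by simp
  qed
  then have "\<bar>frac (X 2) - frac (X 1)\<bar> < 1 / real B ^ m" by (intro digits_eq_imp_close[OF B])
  moreover have "frac (X 2) - frac (X 1) = d - of_int (\<lfloor>X 2\<rfloor> - \<lfloor>X 1\<rfloor>)" by (simp add: frac_def X_def)
  ultimately show ?thesis by metis
qed

section \<open>Coincidences among the coefficients\<close>

lemma binomial_eq_imp:
  assumes eq: "n choose a = n choose b" and ab: "a \<le> n" "b \<le> n"
  shows "b = a \<or> b = n - a"
proof -
  \<comment> \<open>Folding by symmetry into the lower half, where binomial coefficients increase
    strictly.\<close>
  define f where "f a = min a (n - a)" for a
  have f: "n choose f a = n choose a" "2 * f a \<le> n" if "a \<le> n" for a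
    using that binomial_symmetric[OF that] by (auto simp: f_def min_def)
  have "f a = f b"
    using binomial_strict_mono[of "f a" "f b" n] binomial_strict_mono[of "f b" "f a" n] f[OF ab(1)] f[OF ab(2)] eq
    by (metis nat_neq_iff)
  then show ?thesis using ab by (auto simp: f_def min_def split: if_splits)
qed

text \<open>Cancelling coefficients have equal absolute values, hence equal binomial coefficients;
  as the indices differ, they must be mirror images.\<close>

lemma vcoeff_add_eq_0:
  assumes "i \<in> {1..k}" "j \<in> {1..k}" "i \<noteq> j" "vcoeff k i + vcoeff k j = 0"
  shows "j = k + 1 - i"
proof -
  have "\<bar>vcoeff k i\<bar> = \<bar>vcoeff k j\<bar>" using assms(4) by linarith
  then have "(k - 1) choose (i - 1) = (k - 1) choose (j - 1)" by (simp add: vcoeff_def abs_mult)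
  from binomial_eq_imp[OF this] have "j - 1 = i - 1 \<or> j - 1 = k - 1 - (i - 1)" using assms by (simp add: diff_le_mono)
  then show ?thesis using assms by auto
qed

lemma vcoeff_nonzero: "i \<in> {1..k} \<Longrightarrow> vcoeff k i \<noteq> 0"
  by (auto simp: vcoeff_def)

text \<open>Suppose all color classes had total coefficient 0. No class is a singleton, as
  coefficients are nonzero, and none contains three indices, by \<open>digit_color_triple\<close>
  and \<open>far\<close>. So the classes are pairs with cancelling coefficients, that is, mirror
  pairs, which contradicts \<open>digit_color_symmetric\<close>.\<close>

lemma digit_color_nondegenerate:
  fixes x d :: real and c :: "nat \<Rightarrow> nat"
  defines "X \<equiv> \<lambda>i::nat. x + (real i - 1) * d"
  assumes k: "k \<ge> 4" "even k" and B: "B \<ge> 1" and c: "asym_coloring k r B c"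
    and far: "\<And>q z. q \<in> {1..<k} \<Longrightarrow> \<bar>real q * d - of_int z\<bar> \<ge> 1 / real B ^ m"
  shows "\<exists>i\<in>{1..k}. (\<Sum>j | j \<in> {1..k} \<and> digit_color k B m c (X j) = digit_color k B m c (X i). vcoeff k j) \<noteq> 0"
proof (rule ccontr)
  let ?col = "\<lambda>i. digit_color k B m c (X i)"
  assume "\<not> ?thesis"
  then have zero: "(\<Sum>j | j \<in> {1..k} \<and> ?col j = ?col i. vcoeff k j) = 0" if "i \<in> {1..k}" for i
    using that by blast
  \<comment> \<open>The middle term is a convex combination of the outer ones, with the integer
    weights e - b and b - a of sum less than k.\<close>
  have no_triple: False if "1 \<le> a" "a < b" "b < e" "e \<le> k" "?col a = ?col b" "?col e = ?col b" for a b e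
  proof -
    have "real (e - b) * X a + real (b - a) * X e - real (e - b + (b - a)) * X b = 0"
      using that by (simp add: X_def of_nat_diff algebra_simps)
    then have "real (e - b) * X a + real (b - a) * X e - real (e - b + (b - a)) * X b \<in> \<int>" by simp
    from digit_color_triple[OF this _ _ _ B that(5,6)] that
    have "\<bar>frac (X a) - frac (X b)\<bar> < 1 / real B ^ m" by simp
    moreover have "frac (X a) - frac (X b) = - (real (b - a) * d - of_int (\<lfloor>X b\<rfloor> - \<lfloor>X a\<rfloor>))"
      using that by (simp add: frac_def X_def of_nat_diff algebra_simps)
    ultimately have "\<bar>real (b - a) * d - of_int (\<lfloor>X b\<rfloor> - \<lfloor>X a\<rfloor>)\<bar> < 1 / real B ^ m" by simp
    moreover have "b - a \<in> {1..<k}" using that by auto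
    ultimately show False using far[of "b - a" "\<lfloor>X b\<rfloor> - \<lfloor>X a\<rfloor>"] by linarith
  qed
  have sym: "?col i = ?col (k + 1 - i)" if i: "i \<in> {1..k}" for i
  proof -
    let ?S = "{j. j \<in> {1..k} \<and> ?col j = ?col i}"
    have "\<exists>j\<in>?S. j \<noteq> i"
    proof (rule ccontr)
      assume "\<not> ?thesis" 
      then have "?S = {i}" using i by auto
      then show False using zero[OF i] vcoeff_nonzero[OF i] by simp
    qed
    then obtain j where j: "j \<in> {1..k}" "?col j = ?col i" "j \<noteq> i" by blast
    have "?S = {i, j}"
    proof (intro equalityI subsetI)
      fix l assume "l \<in> ?S"
      then have l: "1 \<le> l" "l \<le> k" "?col l = ?col i" by auto
      show "l \<in> {i, j}"
      proof (rule ccontr)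
        assume "l \<notin> {i, j}"
        then consider "i < j" "j < l" | "j < i" "i < l" | "i < l" "l < j" | "j < l" "l < i" | "l < i" "i < j" | "l < j" "j < i"
          using j(3) by (metis insertCI linorder_neqE_nat)
        then show False using no_triple l i j by cases (metis atLeastAtMost_iff)+
      qed
    qed (use i j in auto)
    then have "vcoeff k i + vcoeff k j = 0" using zero[OF i] j(3) by simp
    then show ?thesis using vcoeff_add_eq_0[OF i j(1)] j by auto
  qed
  obtain z :: int where "\<bar>d - of_int z\<bar> < 1 / real B ^ m"
    using digit_color_symmetric[OF k B c] sym unfolding X_def by blast
  then show False using far[of 1 z] k by simp
qed

section \<open>The extremal quantity\<close>

lemma sum_abs_vcoeff: 
  assumes "k \<ge> 1" shows "(\<Sum>i=1..k. \<bar>vcoeff k i\<bar>) = 2 ^ (k - 1)"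
proof -
  have "(\<Sum>i=1..k. \<bar>vcoeff k i\<bar>) = (\<Sum>i=1..k. int ((k - 1) choose (i - 1)))"
    by (simp add: vcoeff_def abs_mult)
  also have "\<dots> = (\<Sum>i\<le>k - 1. int ((k - 1) choose i))"
    using assms by (intro sum.reindex_bij_witness[where i = Suc and j = "\<lambda>i. i - 1"]) auto
  also have "\<dots> = int (2 ^ (k - 1))" by (simp only: choose_row_sum flip: of_nat_sum)
  finally show ?thesis by simp
qed

lemma measurable_digit_color:
  "digit_color K B m c \<in> borel \<rightarrow>\<^sub>M count_space UNIV"
proof -
  have frac_meas [measurable]: "(\<lambda>x. frac (f x)) \<in> borel_measurable borel" if "f \<in> borel_measurable borel" for f :: "real \<Rightarrow> real"
    using that unfolding frac_def by measurable
  have [measurable]: "(\<lambda>x. nat \<lfloor>real K * frac (real B ^ j * x)\<rfloor>) \<in> borel \<rightarrow>\<^sub>M count_space UNIV" for K j by measurable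
  have [measurable]: "digit B j \<in> borel \<rightarrow>\<^sub>M count_space UNIV" for j unfolding digit_def by measurable
  have map_meas: "(\<lambda>x. map (\<lambda>j. h j x) js) \<in> borel \<rightarrow>\<^sub>M count_space UNIV"
    if "\<And>j. h j \<in> borel \<rightarrow>\<^sub>M (count_space UNIV :: nat measure)" for h :: "nat \<Rightarrow> real \<Rightarrow> nat" and js
  proof (induction js)
    case (Cons j js)
    note [measurable] = that this
    show ?case by simp
  qed simp
  have [measurable]: "(\<lambda>x. map (\<lambda>j. nat \<lfloor>real K * frac (real B ^ j * x)\<rfloor>) [0..<Suc m]) \<in> borel \<rightarrow>\<^sub>M count_space UNIV"
    "(\<lambda>x. map (\<lambda>j. c (digit B j x)) [0..<m]) \<in> borel \<rightarrow>\<^sub>M count_space UNIV"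
    by (rule map_meas, measurable)+
  show ?thesis unfolding digit_color_def by measurable
qed

text \<open>The color depends on finitely many floors of T s only. If one of them differs at s and
  s', a fraction z / T with z the larger floor lies between the two points, hence within their
  distance of s'.\<close>

lemma digit_color_step:
  assumes "B \<ge> 1" "K \<ge> 1" and s: "s \<in> {0..<1}" "s' \<in> {0..<1}" and ne: "digit_color K B m c s \<noteq> digit_color K B m c s'"
  shows "\<exists>a\<in>(\<Union>T\<in>(\<lambda>j. B ^ j) ` {..m} \<union> (\<lambda>j. K * B ^ j) ` {..m}. (\<lambda>z. real z / real T) ` {..T}). \<bar>s' - a\<bar> \<le> \<bar>s - s'\<bar>"
proof (rule ccontr)
  assume no: "\<not> ?thesis"
  have fl: "\<lfloor>real T * s\<rfloor> = \<lfloor>real T * s'\<rfloor>" if T: "T \<in> (\<lambda>j. B ^ j) ` {..m} \<union> (\<lambda>j. K * B ^ j) ` {..m}" for T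
  proof (rule ccontr)
    assume neq: "\<lfloor>real T * s\<rfloor> \<noteq> \<lfloor>real T * s'\<rfloor>"
    have T0: "real T > 0" using T assms(1,2) by auto
    define z where "z = max \<lfloor>real T * s\<rfloor> \<lfloor>real T * s'\<rfloor>"
    have "0 \<le> real T * s" "real T * s < real T" "0 \<le> real T * s'" "real T * s' < real T" using s T0 by auto
    then have z: "0 \<le> z" "z \<le> int T" unfolding z_def by linarith+
    have "(real T * s < of_int z \<and> of_int z \<le> real T * s') \<or> (real T * s' < of_int z \<and> of_int z \<le> real T * s)"
      using neq unfolding z_def by linarith
    then have "\<bar>real T * s' - of_int z\<bar> \<le> \<bar>real T * s - real T * s'\<bar>" by linarith
    then have "real T * \<bar>s' - of_int z / real T\<bar> \<le> real T * \<bar>s - s'\<bar>"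
      using T0 by (simp add: abs_mult_pos' right_diff_distrib)
    then have "\<bar>s' - real (nat z) / real T\<bar> \<le> \<bar>s - s'\<bar>" using T0 z by simp
    moreover have "nat z \<in> {..T}" using z by simp
    ultimately show False using no T by blast
  qed
  have fr: "\<lfloor>real n * frac (real B ^ j * x)\<rfloor> = \<lfloor>real (n * B ^ j) * x\<rfloor> - int n * \<lfloor>real (B ^ j) * x\<rfloor>" for x n j
  proof -
    have "real n * frac (real B ^ j * x) = real (n * B ^ j) * x - of_int (int n * \<lfloor>real (B ^ j) * x\<rfloor>)"
      by (simp add: frac_def algebra_simps)
    then show ?thesis by (simp only: floor_diff_of_int)
  qed
  have "digit B j s = digit B j s'" if "j < m" for j
  proof -
    have "\<lfloor>real (B * B ^ j) * s\<rfloor> = \<lfloor>real (B * B ^ j) * s'\<rfloor>" 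
    proof -
      have "B ^ Suc j \<in> (\<lambda>j. B ^ j) ` {..m}" using that by (intro imageI) simp
      then show ?thesis using fl[of "B ^ Suc j"] by simp
    qed
    moreover have "\<lfloor>real (B ^ j) * s\<rfloor> = \<lfloor>real (B ^ j) * s'\<rfloor>" using fl[of "B ^ j"] that by auto
    ultimately show ?thesis unfolding digit_def fr by simp
  qed
  moreover have "\<lfloor>real K * frac (real B ^ j * s)\<rfloor> = \<lfloor>real K * frac (real B ^ j * s')\<rfloor>" if "j \<le> m" for j
  proof -
    have "K * B ^ j \<in> (\<lambda>j. K * B ^ j) ` {..m}" "B ^ j \<in> (\<lambda>j. B ^ j) ` {..m}" using that by blast+
    then show ?thesis unfolding fr using fl[of "B ^ j"] fl[of "K * B ^ j"] by simp
  qed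
  ultimately show False using ne by (simp add: digit_color_def)
qed

text \<open>
  In the factor \<open>4\<^sup>k (k R\<^sup>k\<^sup>-\<^sup>1 + 1)\<close>, one \<open>2\<^sup>k\<close> keeps the linear form of the integer points,
  scaled into the unit interval, from wrapping around the circle, and the other one makes the
  intervals around these points too short to compensate a nonzero value.
\<close>

lemma rho_tilde_le_digit:
  fixes c :: "nat \<Rightarrow> nat" and m :: nat
  assumes k: "k \<ge> 4" "even k" and B: "B \<ge> 1" and c: "asym_coloring k r B c"
  defines "R \<equiv> k ^ Suc m * (r ^ m * Suc (m * B\<^sup>2))"
  assumes \<alpha>: "0 < \<alpha>" "\<alpha> * (4 ^ k * (real k * real R ^ (k - 1) + 1)) \<le> 1"
  shows "rho_tilde k \<alpha> \<le> \<alpha> ^ (k - 1) * (4 * real k / real B ^ m)"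
proof -
  define C where "C = {xs. set xs \<subseteq> {..<k} \<and> length xs = Suc m} \<times>
    ({xs. set xs \<subseteq> {..<r} \<and> length xs = m} \<times> {..m * B\<^sup>2})"
  define col where "col = digit_color k B m c"
  have C: "finite C" "card C = R"
    by (simp_all add: C_def R_def finite_lists_length_eq card_cartesian_product card_lists_length_eq)
  have col: "col x \<in> C" for x
    using digit_color_in[of k B c r m x] k B c by (simp add: col_def C_def asym_coloring_def)
  define n where "n = k * R ^ (k - 1)"
  obtain p :: "nat list \<times> nat list \<times> nat \<Rightarrow> nat" where p: "\<And>c. c \<in> C \<Longrightarrow> p c \<le> n"
    "\<And>f e. f \<in> {1..k} \<rightarrow> C \<Longrightarrow> e \<in> C \<Longrightarrow> (\<Sum>i | i \<in> {1..k} \<and> f i = e. vcoeff k i) \<noteq> 0 \<Longrightarrow> (\<Sum>i=1..k. vcoeff k i * int (p (f i))) \<noteq> 0"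
  proof -
    obtain p :: "nat list \<times> nat list \<times> nat \<Rightarrow> nat" where "(\<forall>c\<in>C. p c \<le> n) \<and>
      (\<forall>f\<in>{1..k} \<rightarrow> C. (\<exists>e\<in>C. (\<Sum>i | i \<in> {1..k} \<and> f i = e. vcoeff k i) \<noteq> 0) \<longrightarrow> (\<Sum>i=1..k. vcoeff k i * int (p (f i))) \<noteq> 0)"
      using greedy_points[of "{1..k}" C "vcoeff k"] unfolding n_def C(2) card_atLeastAtMost diff_Suc_1
      using C(1) by blast
    then show ?thesis by (intro that[of p]) blast+
  qed
  \<comment> \<open>The points will be p c / P. The summand 1 leaves room for an interval of length
    \<alpha> below 1, and 2^k exceeds the sum 2^(k-1) of the absolute values of the
    coefficients.\<close>
  define P where "P = 2 ^ k * (real n + 1)"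
  have P: "P > 0" by (simp add: P_def)
  have four: "(4::real) ^ k = 2 ^ k * 2 ^ k" by (simp flip: power_mult_distrib)
  have \<alpha>P: "2 ^ k * (\<alpha> * P) \<le> 1" using \<alpha>(2) by (simp add: P_def n_def four algebra_simps)
  have "1 * (\<alpha> * P) \<le> 2 ^ k * (\<alpha> * P)" using \<alpha> P by (intro mult_right_mono) auto
  then have \<alpha>P1: "\<alpha> * P \<le> 1" using \<alpha>P by linarith
  have P_ge: "real n + 1 \<le> P"
    using mult_right_mono[of 1 "2 ^ k" "real n + 1"] by (simp add: P_def)
  define g where "g s = real (p (col s)) / P" for s
  have g0: "0 \<le> g s" for s using P by (simp add: g_def)
  have g1: "g s + \<alpha> \<le> 1" for s
  proof -
    have "(g s + \<alpha>) * P = real (p (col s)) + \<alpha> * P" using P by (simp add: g_def field_simps)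
    also have "\<dots> \<le> 1 * P" using p(1)[OF col[of s]] \<alpha>P1 P_ge by simp
    finally show ?thesis using P by (simp only: mult_le_cancel_right_pos)
  qed
  have g_meas: "g \<in> borel_measurable borel"
    unfolding g_def col_def
    by (rule measurable_compose[OF measurable_digit_color, of "\<lambda>e. real (p e) / P"]) simp
  have "range g \<subseteq> (\<lambda>e. real (p e) / P) ` C" using col by (auto simp: g_def)
  then have g_fin: "finite (range g)" using C by (meson finite_imageI finite_subset)
  define A where "A = (\<Union>T\<in>(\<lambda>j. B ^ j) ` {..m} \<union> (\<lambda>j. k * B ^ j) ` {..m}. (\<lambda>z. real z / real T) ` {..T})"
  have A: "finite A" by (auto simp: A_def)
  have riem: "riemann_integrable_torus (strip g \<alpha>)"
  proof (rule strip_riemann_integrable[OF g_meas g_fin A])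
    fix s s' :: real assume s: "s \<in> {0..<1}" "s' \<in> {0..<1}" and "g s \<noteq> g s'"
    then have "digit_color k B m c s \<noteq> digit_color k B m c s'" by (auto simp: g_def col_def)
    then show "\<exists>a\<in>A. \<bar>s' - a\<bar> \<le> \<bar>s - s'\<bar>"
      unfolding A_def using s k B by (intro digit_color_step) auto
  qed
  define E where "E = near_torsion k (1 / real B ^ m)"
  have "rho_tilde k \<alpha> \<le> Lambda_tilde k (strip g \<alpha>)"
    using riem strip_constant_first_marginal[OF g0 g1] \<alpha>
    by (intro rho_tilde_le) (auto simp: strip_def)
  also have "\<dots> \<le> \<alpha> ^ (k - 1) * measure circle_measure E"
  proof (rule Lambda_tilde_strip_le[OF _ g_meas g0 g1])
    show "1 \<le> k" "0 \<le> \<alpha>" using k \<alpha> by auto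
    show "E \<in> sets borel" unfolding E_def by (rule near_torsion_measurable)
    fix x d y assume d: "d \<notin> E" and sum0: "(\<Sum>i=1..k. int_scale (vcoeff k i) (y i)) = 0"
      and one: "\<And>i. i \<in> {1..k} \<Longrightarrow> strip g \<alpha> (x + int_scale (int i - 1) d, y i) = 1"
    define X where "X i = crep x + (real i - 1) * crep d" for i :: nat
    have col_X: "col (crep (x + int_scale (int i - 1) d)) = col (X i)" for i
    proof -
      have "x + int_scale (int i - 1) d = circle_of (X i)"
        by (simp add: X_def circle_of_add flip: circle_of_int_scale)
          (metis circle_of_crep circle_of_int_scale of_int_diff of_int_of_nat_eq of_int_1)
      then have "crep (x + int_scale (int i - 1) d) = X i + of_int (- \<lfloor>X i\<rfloor>)" by (simp add: frac_def)
      then show ?thesis unfolding col_def by (simp only: digit_color_add_int)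
    qed
    have "1 / real B ^ m \<le> \<bar>real q * crep d - of_int z\<bar>" if "q \<in> {1..<k}" for q z
      using d that by (force simp: E_def near_torsion_def not_less)
    from digit_color_nondegenerate[OF k B c this, of "crep x"]
    obtain i where "i \<in> {1..k}" "(\<Sum>j | j \<in> {1..k} \<and> col (X j) = col (X i). vcoeff k j) \<noteq> 0"
      unfolding X_def col_def by blast
    then have Z0: "(\<Sum>i=1..k. vcoeff k i * int (p (col (X i)))) \<noteq> 0"
      using col by (intro p(2)[of "\<lambda>i. col (X i)" "col (X i)"]) auto
    define Z where "Z = (\<Sum>i=1..k. vcoeff k i * int (p (col (X i))))"
    \<comment> \<open>The offset of y_i inside its interval. It splits the linear form S into Z / P,
      from the integer points, and an error W of size at most 2^(k-1) \<alpha>.\<close>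
    define \<sigma> where "\<sigma> i = crep (y i) - real (p (col (X i))) / P" for i
    have \<sigma>: "0 \<le> \<sigma> i" "\<sigma> i \<le> \<alpha>" if "i \<in> {1..k}" for i
      using one[OF that] by (auto simp: strip_def g_def col_X \<sigma>_def split: if_splits)
    define S where "S = (\<Sum>i=1..k. of_int (vcoeff k i) * crep (y i))"
    have "circle_of S = 0" using sum0 by (simp add: S_def circle_of_sum circle_of_int_scale)
    then have "S \<in> \<int>" by (simp add: circle_of_eq_0_iff)
    define W where "W = (\<Sum>i=1..k. of_int (vcoeff k i) * \<sigma> i)"
    have "S = (\<Sum>i=1..k. of_int (vcoeff k i) * (real (p (col (X i))) / P) + of_int (vcoeff k i) * \<sigma> i)"
      unfolding S_def by (intro sum.cong) (auto simp: \<sigma>_def algebra_simps)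
    then have S: "S = of_int Z / P + W" by (simp add: Z_def W_def sum.distrib sum_divide_distrib)
    have abs: "(\<Sum>i=1..k. \<bar>real_of_int (vcoeff k i)\<bar>) = 2 ^ (k - 1)"
      using arg_cong[OF sum_abs_vcoeff[of k], of real_of_int] k by simp
    have "\<bar>W\<bar> \<le> (\<Sum>i=1..k. \<bar>real_of_int (vcoeff k i)\<bar> * \<alpha>)"
      unfolding W_def using \<sigma> by (intro order_trans[OF sum_abs] sum_mono) (auto simp: abs_mult intro!: mult_left_mono)
    then have "\<bar>W\<bar> \<le> 2 ^ (k - 1) * \<alpha>" by (simp only: abs flip: sum_distrib_right)
    moreover have two: "(2::real) * 2 ^ (k - 1) = 2 ^ k" using k by (cases k) auto
    ultimately have "2 * \<bar>W\<bar> \<le> 2 ^ k * \<alpha>" unfolding two[symmetric] by linarith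
    then have "2 * \<bar>W\<bar> * P \<le> 2 ^ k * \<alpha> * P" using P by (intro mult_right_mono) auto
    also have "\<dots> \<le> 1" using \<alpha>P by (simp only: mult.assoc)
    finally have W: "2 * \<bar>W * P\<bar> \<le> 1" using P by (simp add: abs_mult)
    have "\<bar>real_of_int Z\<bar> \<le> (\<Sum>i=1..k. \<bar>real_of_int (vcoeff k i)\<bar> * real n)"
      unfolding Z_def of_int_sum using p(1)[OF col]
      by (intro order_trans[OF sum_abs] sum_mono) (auto simp: abs_mult intro!: mult_left_mono)
    then have "\<bar>real_of_int Z\<bar> \<le> 2 ^ (k - 1) * real n" by (simp only: abs flip: sum_distrib_right)
    moreover have "(2::real) ^ (k - 1) \<le> 2 ^ k" by (rule power_increasing) auto
    then have "2 ^ (k - 1) * real n \<le> 2 ^ k * real n" by (rule mult_right_mono) simp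
    moreover have "P = 2 ^ k * real n + 2 ^ k" by (simp add: P_def algebra_simps)
    moreover have "(1::real) \<le> 2 ^ k" by simp
    ultimately have Z: "\<bar>real_of_int Z\<bar> \<le> P - 1" by linarith
    have SP: "S * P = of_int Z + W * P" using P by (simp add: S field_simps)
    \<comment> \<open>The integer S is too small to be nonzero; but S = 0 would give the nonzero
      integer Z an absolute value of at most 1 / 2.\<close>
    have "\<bar>S * P\<bar> < 1 * P" using SP Z W by linarith
    then have "\<bar>S\<bar> < 1" using P by (simp add: abs_mult)
    then have "S = 0" using \<open>S \<in> \<int>\<close> Ints_nonzero_abs_less1 by blast
    then have "of_int Z + W * P = 0" using SP by simp
    moreover have "1 \<le> \<bar>real_of_int Z\<bar>" using Z0 unfolding Z_def[symmetric] by linarith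
    ultimately show False using W by linarith
  qed
  also have "\<dots> \<le> \<alpha> ^ (k - 1) * (4 * real k / real B ^ m)"
  proof (rule mult_left_mono)
    have "measure circle_measure E \<le> 4 * real k * (1 / real B ^ m)"
      unfolding E_def using B by (intro measure_near_torsion_le) auto
    then show "measure circle_measure E \<le> 4 * real k / real B ^ m" by simp
  qed (use \<alpha> in simp)
  finally show ?thesis .
qed

text \<open>A horizontal band, with all differences counted as exceptional. This trivial bound
  serves when e is not positive and when \<alpha> is too large for the digit construction.\<close>

lemma rho_tilde_le_power:
  assumes "k \<ge> 1" "0 < \<alpha>" "\<alpha> < 1"
  shows "rho_tilde k \<alpha> \<le> \<alpha> ^ (k - 1)"
proof -
  have "riemann_integrable_torus (strip (\<lambda>_. 0) \<alpha>)"
    by (rule strip_riemann_integrable[where A = "{}"]) auto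
  then have "rho_tilde k \<alpha> \<le> Lambda_tilde k (strip (\<lambda>_. 0) \<alpha>)"
    using assms by (intro rho_tilde_le strip_constant_first_marginal) (auto simp: strip_def)
  also have "\<dots> \<le> \<alpha> ^ (k - 1) * measure circle_measure UNIV"
    using assms by (intro Lambda_tilde_strip_le) auto
  also have "\<dots> = \<alpha> ^ (k - 1)" using circle_prob.prob_space by simp
  finally show ?thesis .
qed

text \<open>With m digits, R grows at most like \<rho>^m, so the smallness condition on \<alpha> is
  met until \<alpha> is about \<rho>^(-m (k-1)). The gain is B^(-m) = r^(-s m L), which in terms of
  \<alpha> is a power with exponent L / ((1 + \<eta>) (k - 1)), at least e.\<close>

lemma rho_tilde_power_bound:
  fixes k r N s :: nat and \<epsilon> L \<eta> e :: real
  assumes k: "k \<ge> 4" "even k" and r: "r \<ge> 2" and N: "N \<ge> 2"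
    and c: "asym_coloring k (r ^ s) (N ^ s) c"
    and L: "L = log (real r) (real N)" and e: "e = L / (real k - 1) - \<epsilon>" "e > 0" and \<epsilon>: "\<epsilon> > 0"
    and \<eta>: "\<eta> = \<epsilon> * (real k - 1) / L" and s: "2 * real k \<le> real r powr (real s * \<eta>)"
  shows "\<exists>C. \<forall>\<alpha>. 0 < \<alpha> \<and> \<alpha> < 1 \<longrightarrow> rho_tilde k \<alpha> \<le> C * \<alpha> powr (real k - 1 + e)"
proof -
  define B where "B = N ^ s"
  have B: "B \<ge> 1" using N by (simp add: B_def)
  have Lpos: "L > 0" using r N by (simp add: L)
  have rL: "real r powr L = real N" using r N by (simp add: L)
  define R where "R m = k ^ Suc m * ((r ^ s) ^ m * Suc (m * B\<^sup>2))" for m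
  define Q where "Q m = 4 ^ k * (real k * real (R m) ^ (k - 1) + 1)" for m
  \<comment> \<open>Each digit multiplies R by r^s for its color and by k for a leading part, and a
    factor 2 absorbs the linear growth of the sum of squares. The choice of s hides 2 k in r^(s
    \<eta>).\<close>
  define \<rho> where "\<rho> = real r powr (real s * (1 + \<eta>))"
  define C1 where "C1 = real k ^ 2 * real r ^ s * (real B ^ 2 + 1)"
  define C2 where "C2 = 4 ^ k * (2 * real k * C1 ^ (k - 1))"
  have \<rho>: "\<rho> \<ge> 2 * real k * real r ^ s"
    using s r unfolding \<rho>_def by (simp add: distrib_left powr_add powr_realpow)
  have \<rho>0: "\<rho> > 0" using r by (simp add: \<rho>_def)
  have C1: "C1 \<ge> 1"
    unfolding C1_def using k r by (intro mult_ge1_I one_le_power) auto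
  have C2: "C2 > 0" using C1 k by (simp add: C2_def)
  have R1: "real (R m) \<ge> 1" for m
  proof -
    have "R m > 0" using k r by (simp add: R_def)
    then show ?thesis by simp
  qed
  have R_le: "real (R (Suc m)) \<le> C1 * \<rho> ^ m" for m
  proof -
    have "real (Suc m) \<le> 2 ^ m" by (induction m) auto
    then have "real (Suc m) * real B ^ 2 + 1 \<le> 2 ^ m * real B ^ 2 + 2 ^ m"
      by (intro add_mono mult_right_mono) auto
    then have "real (Suc (Suc m * B\<^sup>2)) \<le> 2 ^ m * (real B ^ 2 + 1)" by (simp add: algebra_simps)
    then have "real (R (Suc m)) \<le> real k ^ Suc (Suc m) * ((real r ^ s) ^ Suc m * (2 ^ m * (real B ^ 2 + 1)))"
      unfolding R_def of_nat_mult of_nat_power by (intro mult_left_mono) auto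
    also have "\<dots> = C1 * (2 * real k * real r ^ s) ^ m"
      by (simp add: C1_def power_mult_distrib power2_eq_square algebra_simps)
    also have "\<dots> \<le> C1 * \<rho> ^ m" using \<rho> C1 by (intro mult_left_mono power_mono) auto
    finally show ?thesis .
  qed
  have Q_le: "Q (Suc m) \<le> C2 * (\<rho> ^ m) ^ (k - 1)" for m
  proof -
    have "1 * 1 \<le> real k * real (R (Suc m)) ^ (k - 1)"
      using k R1 by (intro mult_mono one_le_power) auto
    then have "Q (Suc m) \<le> 4 ^ k * (2 * real k * real (R (Suc m)) ^ (k - 1))" by (simp add: Q_def)
    also have "\<dots> \<le> 4 ^ k * (2 * real k * (C1 * \<rho> ^ m) ^ (k - 1))"
      using R_le by (intro mult_left_mono power_mono) auto
    finally show ?thesis by (simp add: C2_def power_mult_distrib algebra_simps)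
  qed
  have Qpos: "Q m > 0" for m
    unfolding Q_def by (intro mult_pos_pos add_nonneg_pos) auto
  have Q_ge: "Q m \<ge> real m" for m
  proof -
    have "m < 2 ^ m" by (rule less_exp)
    also have "\<dots> \<le> k ^ Suc m" using k by (intro order_trans[OF power_mono[of 2 k m]] power_increasing) auto
    also have "\<dots> \<le> R m"
    proof -
      have "1 \<le> (r ^ s) ^ m * Suc (m * B\<^sup>2)" using r by (simp add: Suc_le_eq del: mult_Suc_right)
      then show ?thesis unfolding R_def by (metis mult.right_neutral mult_le_mono2)
    qed
    also have "\<dots> \<le> R m ^ (k - 1)" using R1[of m] k by (intro self_le_power) auto
    finally have "real m \<le> real (R m) ^ (k - 1)" by (simp flip: of_nat_power)
    also have "\<dots> \<le> real k * real (R m) ^ (k - 1) + 1" using mult_right_mono[of 1 "real k" "real (R m) ^ (k - 1)"] k by simp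
    also have "\<dots> \<le> Q m" unfolding Q_def using mult_right_mono[of 1 "4 ^ k" "real k * real (R m) ^ (k - 1) + 1"] by simp
    finally show ?thesis .
  qed
  have exponent: "(\<rho> ^ m) ^ (k - 1) = real r powr (real m * (real s * (1 + \<eta>) * (real k - 1)))" for m
  proof -
    have "(\<rho> ^ m) ^ (k - 1) = \<rho> powr (real (m * (k - 1)))" using \<rho>0 by (simp only: powr_realpow power_mult)
    also have "\<dots> = real r powr (real s * (1 + \<eta>) * real (m * (k - 1)))" unfolding \<rho>_def by (rule powr_powr)
    finally show ?thesis using k by (simp add: of_nat_diff algebra_simps)
  qed
  \<comment> \<open>Since (k - 1) e = (1 - \<eta>) L, the left side is (1 - \<eta>^2) L.\<close>
  have eL: "(1 + \<eta>) * (real k - 1) * e \<le> L"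
  proof -
    have "(real k - 1) * e = L - \<epsilon> * (real k - 1)" using k by (simp add: e field_simps)
    then have "(1 + \<eta>) * (real k - 1) * e = (1 + \<epsilon> * (real k - 1) / L) * (L - \<epsilon> * (real k - 1))"
      by (simp add: \<eta> mult.assoc)
    also have "\<dots> = L - (\<epsilon> * (real k - 1))\<^sup>2 / L" using Lpos by (simp add: field_simps power2_eq_square)
    also have "\<dots> \<le> L" using Lpos by simp
    finally show ?thesis .
  qed
  have split: "\<alpha> powr (real k - 1 + e) = \<alpha> ^ (k - 1) * \<alpha> powr e" if "\<alpha> > 0" for \<alpha> :: real
    using that k by (simp add: powr_add of_nat_diff flip: powr_realpow)
  \<comment> \<open>The second summand takes care of those \<alpha> for which not even m = 0 is
    admissible.\<close>
  define C where "C = 4 * real k * C2 powr e + Q 0 powr e"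
  show ?thesis
  proof (intro exI[of _ C] allI impI, elim conjE)
    fix \<alpha> :: real assume \<alpha>: "0 < \<alpha>" "\<alpha> < 1"
    have pos: "0 \<le> \<alpha> ^ (k - 1) * \<alpha> powr e" using \<alpha> by simp
    show "rho_tilde k \<alpha> \<le> C * \<alpha> powr (real k - 1 + e)"
    proof (cases "\<alpha> * Q 0 \<le> 1")
      case False
      then have "1 powr e \<le> (\<alpha> * Q 0) powr e" using e by (intro powr_mono2) auto
      then have 1: "1 \<le> Q 0 powr e * \<alpha> powr e" using \<alpha> Qpos[of 0] by (simp add: powr_mult mult.commute)
      have "rho_tilde k \<alpha> \<le> \<alpha> ^ (k - 1) * 1" using rho_tilde_le_power[of k \<alpha>] k \<alpha> by simp
      also have "\<dots> \<le> \<alpha> ^ (k - 1) * (Q 0 powr e * \<alpha> powr e)" using 1 \<alpha> by (intro mult_left_mono) auto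
      also have "\<dots> = Q 0 powr e * (\<alpha> ^ (k - 1) * \<alpha> powr e)" by (simp add: mult.left_commute)
      also have "\<dots> \<le> C * (\<alpha> ^ (k - 1) * \<alpha> powr e)"
        using pos by (intro mult_right_mono) (auto simp: C_def)
      finally show ?thesis using split \<alpha> by simp
    next
      case True
      \<comment> \<open>Stop just before admissibility first fails: m satisfies the condition on
        \<alpha> and m + 1 violates it.\<close>
      define m where "m = (LEAST m. \<not> \<alpha> * Q (Suc m) \<le> 1)"
      have "\<exists>m. \<not> \<alpha> * Q (Suc m) \<le> 1"
      proof -
        obtain m where "1 / \<alpha> < real m" using reals_Archimedean2 by blast
        then have "1 < \<alpha> * real m" using \<alpha> by (simp add: field_simps)
        also have "\<dots> \<le> \<alpha> * Q (Suc m)" using \<alpha> Q_ge[of "Suc m"] by (intro mult_left_mono) auto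
        finally show ?thesis by (auto simp: not_le)
      qed
      then have m1: "\<alpha> * Q (Suc m) > 1" unfolding m_def by (metis (no_types, lifting) LeastI_ex not_le)
      have m2: "\<alpha> * Q m \<le> 1"
        using True not_less_Least[of "m - 1" "\<lambda>m. \<not> \<alpha> * Q (Suc m) \<le> 1", folded m_def] by (cases m) auto
      have bound: "rho_tilde k \<alpha> \<le> \<alpha> ^ (k - 1) * (4 * real k / real B ^ m)"
        using rho_tilde_le_digit[OF k B c[folded B_def] \<alpha>(1), of m] m2 by (simp add: Q_def R_def)
      \<comment> \<open>The violation at m + 1 bounds \<alpha> from below. Raised to the power e, it
        bounds B^(-m) by a multiple of the e-th power of \<alpha>.\<close>
      have "1 \<le> \<alpha> * (C2 * (\<rho> ^ m) ^ (k - 1))"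
        using m1 mult_left_mono[OF Q_le[of m], of \<alpha>] \<alpha> by linarith
      then have "1 powr e \<le> (\<alpha> * (C2 * (\<rho> ^ m) ^ (k - 1))) powr e" using e by (intro powr_mono2) auto
      also have "\<dots> = \<alpha> powr e * C2 powr e * real r powr (real m * real s * ((1 + \<eta>) * (real k - 1) * e))"
        unfolding exponent using \<alpha> C2 by (simp add: powr_mult powr_powr algebra_simps)
      also have "\<dots> \<le> \<alpha> powr e * C2 powr e * real r powr (real m * real s * L)"
        using eL r by (intro mult_left_mono powr_mono) auto
      also have "real r powr (real m * real s * L) = real B ^ m"
      proof -
        have "real r powr (real m * real s * L) = (real r powr L) powr (real (s * m))"
          by (simp add: powr_powr algebra_simps)
        also have "\<dots> = real B ^ m" unfolding rL B_def using N by (simp add: powr_realpow power_mult del: of_nat_mult)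
        finally show ?thesis .
      qed
      finally have "1 / real B ^ m \<le> \<alpha> powr e * C2 powr e" using B by (simp add: field_simps)
      then have "\<alpha> ^ (k - 1) * (4 * real k * (1 / real B ^ m)) \<le> \<alpha> ^ (k - 1) * (4 * real k * (\<alpha> powr e * C2 powr e))"
        using \<alpha> by (intro mult_left_mono) auto
      with bound have "rho_tilde k \<alpha> \<le> (4 * real k * C2 powr e) * (\<alpha> ^ (k - 1) * \<alpha> powr e)" by (simp add: algebra_simps)
      also have "\<dots> \<le> C * (\<alpha> ^ (k - 1) * \<alpha> powr e)"
        using pos by (intro mult_right_mono) (auto simp: C_def)
      finally show ?thesis using split \<alpha> by simp
    qed
  qed
qed

theorem theorem2p8:
  fixes k r N :: nat
  assumes "k \<ge> 4" and "even k" and "r \<ge> 2" and "N \<ge> 1"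
    and "\<exists>c \<in> {..<N} \<rightarrow> {..<r}. \<not> (\<exists>n\<in>{..<N}. \<exists>d\<in>{..<N}. d \<noteq> 0 \<and> symmetrically_colored N k c n d)"
  shows "\<forall>\<epsilon>>0. \<exists>C::real. \<forall>\<alpha>::real. 0 < \<alpha> \<and> \<alpha> < 1 \<longrightarrow>
    rho_tilde k \<alpha> \<le> C * \<alpha> powr (real k - 1 + log (real r) (real N) / (real k - 1) - \<epsilon>)"
proof (intro allI impI)
  fix \<epsilon> :: real assume \<epsilon>: "\<epsilon> > 0"
  define L where "L = log (real r) (real N)"
  define e where "e = L / (real k - 1) - \<epsilon>"
  have eq: "real k - 1 + log (real r) (real N) / (real k - 1) - \<epsilon> = real k - 1 + e" by (simp add: e_def L_def)
  show "\<exists>C::real. \<forall>\<alpha>::real. 0 < \<alpha> \<and> \<alpha> < 1 \<longrightarrow>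
    rho_tilde k \<alpha> \<le> C * \<alpha> powr (real k - 1 + log (real r) (real N) / (real k - 1) - \<epsilon>)"
    unfolding eq
  proof (cases "e > 0")
    \<comment> \<open>For e \<le> 0 the trivial bound is already stronger, because \<alpha> <
      1.\<close>
    case False
    have "rho_tilde k \<alpha> \<le> 1 * \<alpha> powr (real k - 1 + e)" if \<alpha>: "0 < \<alpha>" "\<alpha> < 1" for \<alpha>
    proof -
      have "rho_tilde k \<alpha> \<le> \<alpha> ^ (k - 1)" using assms \<alpha> by (intro rho_tilde_le_power) auto
      also have "\<dots> = \<alpha> powr (real k - 1)" using assms \<alpha> by (simp add: of_nat_diff flip: powr_realpow)
      also have "\<dots> \<le> \<alpha> powr (real k - 1 + e)" using \<alpha> False by (intro powr_mono') auto
      finally show ?thesis by simp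
    qed
    then show "\<exists>C. \<forall>\<alpha>. 0 < \<alpha> \<and> \<alpha> < 1 \<longrightarrow> rho_tilde k \<alpha> \<le> C * \<alpha> powr (real k - 1 + e)" by blast
  next
    case True
    have "N \<noteq> 1" using True \<epsilon> by (auto simp: e_def L_def)
    then have N: "N \<ge> 2" using assms(4) by simp
    have L: "L > 0" using assms N by (simp add: L_def)
    define \<eta> where "\<eta> = \<epsilon> * (real k - 1) / L"
    have \<eta>: "\<eta> > 0" using \<epsilon> L assms(1) by (simp add: \<eta>_def)
    \<comment> \<open>So large that r^(s \<eta>) is at least 2 k, the factor lost per digit.\<close>
    obtain s :: nat where s: "log (real r) (2 * real k) / \<eta> < real s" using reals_Archimedean2 by blast
    have "2 * real k = real r powr log (real r) (2 * real k)" using assms by simp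
    also have "\<dots> \<le> real r powr (real s * \<eta>)"
      using s \<eta> assms(3) by (intro powr_mono) (auto simp: field_simps)
    finally have s': "2 * real k \<le> real r powr (real s * \<eta>)" .
    obtain c0 where "c0 \<in> {..<N} \<rightarrow> {..<r}"
      "\<not> (\<exists>n\<in>{..<N}. \<exists>d\<in>{..<N}. d \<noteq> 0 \<and> symmetrically_colored N k c0 n d)" using assms(5) by blast
    then have "asym_coloring k r N c0" by (rule asym_coloringI[OF assms(4)])
    then obtain c where c: "asym_coloring k (r ^ s) (N ^ s) c" using asym_coloring_power[OF _ assms(4)] by blast
    show "\<exists>C. \<forall>\<alpha>. 0 < \<alpha> \<and> \<alpha> < 1 \<longrightarrow> rho_tilde k \<alpha> \<le> C * \<alpha> powr (real k - 1 + e)"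
      by (rule rho_tilde_power_bound[OF assms(1-3) N c L_def e_def True \<epsilon> \<eta>_def s'])
  qed
qed

end
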